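(* Let $\kappa>0$ and let $x,y\in\mathbb R^3$ be such that $0<\|x-y\|<2/\kappa$. Then the space of arcs in $cl(\mathcal R)$ and the space of arcs not in $cl(\mathcal R)$ are in different homotopy classes in $\Sigma(x,y)$. In particular, $\mathcal S(x,y)=cl(\mathcal R)$ is a trapped region.
   Context: A $\kappa$-constrained arc is an embedded arc-length parametrised curve $\gamma:[0,s]\to\mathbb R^3$ with $\gamma(0)\ne\gamma(s)$ that is $C^1$ and piecewise $C^2$ (there are at most finitely many points where the curvature is not defined), with $\|\gamma''(t)\|\le\kappa$ for all $t\in[0,s]$ at which $\gamma''(t)$ is defined. $\Sigma(x,y)$ is the space of $\kappa$-constrained arcs connecting $x$ to $y$, considered with the $C^1$ metric. "Arc" in the claim means an element of $\Sigma(x,y)$. A $\kappa$-constrained homotopy between $\beta,\gamma\in\Sigma(x,y)$ is a continuous one-parameter family of embedded paths $H:[0,1]\to\Sigma(x,y)$ with $H(0)=\beta$ and $H(1)=\gamma$, where each $H(p):[0,s_p]\to\mathbb R^3$ is an element of $\Sigma(x,y)$ parametrised by its own arc length. This is an equivalence relation; its equivalence classes are called homotopy classes in $\Sigma(x,y)$, and each is a path component of $\Sigma(x,y)$. A curve is "in" (or "defined in") a set if its image is contained in that set, and "not in" the set otherwise. Let $B_1,B_2$ be 3-balls of radius $1/\kappa$ such that $\partial B_1\cap\partial B_2$ is a circle $C$ in which $x$ and $y$ are antipodal points. $\mathcal R$ is the open region enclosed by the union of all the short arcs in the family of circles of radius $1/\kappa$ passing through $x$ and $y$ (the short arc of such a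 circle being the shorter of the two arcs into which $x$ and $y$ divide it). $cl$ denotes closure. A compact, connected, minimal with respect to set inclusion set $\mathcal S(x,y)\subset\mathbb R^3$ is said to be a trapped region if the arcs in $\Sigma(x,y)$ defined in $\mathcal S(x,y)$ are embedded and are not $\kappa$-constrained homotopic to arcs not in $\mathcal S(x,y)$.
   Formalization: In the definition of trapped region, the set, and the sets it is compared with for minimality, must contain at least one arc of Σ(x,y); read literally, the empty set satisfies the condition vacuously, so cl(R) would not be minimal. *)

theory Defs
  imports "HOL-Analysis.Analysis"
begin

text \<open>
  A curve \<open>\<gamma> : [0,s] \<rightarrow> \<real>\<^sup>3\<close> is the pair \<open>(s, \<gamma>)\<close>. Requiring \<open>\<gamma> \<in> extensional {0..s}\<close>
  makes the values off \<open>[0,s]\<close> irrelevant, so that equal curves are equal pairs.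
\<close>

type_synonym curve = "real \<times> (real \<Rightarrow> real^3)"

definition velocity :: "real \<Rightarrow> (real \<Rightarrow> real^3) \<Rightarrow> real \<Rightarrow> real^3" where
  "velocity s \<gamma> t = vector_derivative \<gamma> (at t within {0..s})"

definition acceleration :: "real \<Rightarrow> (real \<Rightarrow> real^3) \<Rightarrow> real \<Rightarrow> real^3" where
  "acceleration s \<gamma> t = vector_derivative (velocity s \<gamma>) (at t within {0..s})"

definition C1_curve :: "real \<Rightarrow> (real \<Rightarrow> real^3) \<Rightarrow> bool" where
  "C1_curve s \<gamma> \<longleftrightarrow> 0 < s \<and> \<gamma> \<in> extensional {0..s} \<and>
     (\<forall>t\<in>{0..s}. \<gamma> differentiable (at t within {0..s})) \<and>
     continuous_on {0..s} (velocity s \<gamma>)"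

text \<open>
  An injective \<open>C\<^sup>1\<close> curve of unit speed on a compact interval is an embedding. The predicate
  \<^const>\<open>piecewise_C1_differentiable_on\<close> asks for a continuous derivative of the velocity off a
  finite set (which may contain the endpoints).
\<close>

definition constrained_arc :: "real \<Rightarrow> real \<Rightarrow> (real \<Rightarrow> real^3) \<Rightarrow> bool" where
  "constrained_arc \<kappa> s \<gamma> \<longleftrightarrow>
     C1_curve s \<gamma> \<and> inj_on \<gamma> {0..s} \<and> \<gamma> 0 \<noteq> \<gamma> s \<and>
     (\<forall>t\<in>{0..s}. norm (velocity s \<gamma> t) = 1) \<and>
     velocity s \<gamma> piecewise_C1_differentiable_on {0..s} \<and>
     (\<forall>t\<in>{0..s}. velocity s \<gamma> differentiable (at t within {0..s}) \<longrightarrow>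
        norm (acceleration s \<gamma> t) \<le> \<kappa>)"

definition constrained_arcs :: "real \<Rightarrow> real^3 \<Rightarrow> real^3 \<Rightarrow> curve set" where
  "constrained_arcs \<kappa> x y = {(s, \<gamma>). constrained_arc \<kappa> s \<gamma> \<and> \<gamma> 0 = x \<and> \<gamma> s = y}"

text \<open>
  Arcs of different lengths are compared after proportional reparametrisation to \<open>[0,1]\<close>. The
  distance is the usual \<open>C\<^sup>1\<close> distance of the reparametrised curves. It is set to \<open>0\<close> when one of
  the curves is not \<open>C\<^sup>1\<close>, because the suprema need not exist then.
\<close>

definition rescale :: "curve \<Rightarrow> real \<Rightarrow> real^3" where
  "rescale a u = snd a (fst a * u)"

definition rescale_deriv :: "curve \<Rightarrow> real \<Rightarrow> real^3" where
  "rescale_deriv a u = vector_derivative (rescale a) (at u within {0..1})"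

definition C1_dist :: "curve \<Rightarrow> curve \<Rightarrow> real" where
  "C1_dist a b =
     (if C1_curve (fst a) (snd a) \<and> C1_curve (fst b) (snd b)
      then (SUP u\<in>{0..1}. norm (rescale a u - rescale b u)) +
           (SUP u\<in>{0..1}. norm (rescale_deriv a u - rescale_deriv b u))
      else 0)"

definition arc_space :: "real \<Rightarrow> real^3 \<Rightarrow> real^3 \<Rightarrow> curve topology" where
  "arc_space \<kappa> x y = Metric_space.mtopology (constrained_arcs \<kappa> x y) C1_dist"

definition constrained_homotopic :: "real \<Rightarrow> real^3 \<Rightarrow> real^3 \<Rightarrow> curve \<Rightarrow> curve \<Rightarrow> bool" where
  "constrained_homotopic \<kappa> x y \<beta> \<gamma> \<longleftrightarrow>
     (\<exists>H. pathin (arc_space \<kappa> x y) H \<and> H 0 = \<beta> \<and> H 1 = \<gamma>)"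

definition homotopy_class :: "real \<Rightarrow> real^3 \<Rightarrow> real^3 \<Rightarrow> curve \<Rightarrow> curve set" where
  "homotopy_class \<kappa> x y \<beta> = {\<gamma>. constrained_homotopic \<kappa> x y \<beta> \<gamma>}"

definition arcs_in :: "real \<Rightarrow> real^3 \<Rightarrow> real^3 \<Rightarrow> (real^3) set \<Rightarrow> curve set" where
  "arcs_in \<kappa> x y A = {(s, \<gamma>) \<in> constrained_arcs \<kappa> x y. \<gamma> ` {0..s} \<subseteq> A}"

definition arcs_not_in :: "real \<Rightarrow> real^3 \<Rightarrow> real^3 \<Rightarrow> (real^3) set \<Rightarrow> curve set" where
  "arcs_not_in \<kappa> x y A = {(s, \<gamma>) \<in> constrained_arcs \<kappa> x y. \<not> \<gamma> ` {0..s} \<subseteq> A}"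

text \<open>
  \<open>circular_arc c u v r \<alpha>\<close>, for orthonormal \<open>u\<close> and \<open>v\<close>, is the arc of angle \<open>\<alpha>\<close> of the circle with
  centre \<open>c\<close> and radius \<open>r\<close> in the plane \<open>c + span {u, v}\<close> which starts at \<open>c + r u\<close>. The endpoints of
  this arc divide the circle into two arcs, of angles \<open>\<alpha>\<close> and \<open>2\<pi> - \<alpha>\<close>.
\<close>

definition circle_point :: "real^3 \<Rightarrow> real^3 \<Rightarrow> real^3 \<Rightarrow> real \<Rightarrow> real \<Rightarrow> real^3" where
  "circle_point c u v r \<theta> = c + (r * cos \<theta>) *\<^sub>R u + (r * sin \<theta>) *\<^sub>R v"

definition circular_arc :: "real^3 \<Rightarrow> real^3 \<Rightarrow> real^3 \<Rightarrow> real \<Rightarrow> real \<Rightarrow> (real^3) set" where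
  "circular_arc c u v r \<alpha> = circle_point c u v r ` {0..\<alpha>}"

definition short_arcs :: "real \<Rightarrow> real^3 \<Rightarrow> real^3 \<Rightarrow> (real^3) set set" where
  "short_arcs r x y =
     {circular_arc c u v r \<alpha> | c u v \<alpha>.
        norm u = 1 \<and> norm v = 1 \<and> u \<bullet> v = 0 \<and>
        circle_point c u v r 0 = x \<and> circle_point c u v r \<alpha> = y \<and>
        0 < \<alpha> \<and> \<alpha> < 2 * pi - \<alpha>}"

definition arc_region :: "real \<Rightarrow> real^3 \<Rightarrow> real^3 \<Rightarrow> (real^3) set" where
  "arc_region \<kappa> x y = inside (\<Union> (short_arcs (1 / \<kappa>) x y))"

text \<open>
  The last condition of a trapped region holds vacuously for a set that contains no arc at all, such
  as the empty set, and no other set would then be minimal. Hence a trapping set is required to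
  contain an arc. All elements of \<^const>\<open>constrained_arcs\<close> are embedded, so the injectivity conjunct
  is automatic.
\<close>

definition trapping_set :: "real \<Rightarrow> real^3 \<Rightarrow> real^3 \<Rightarrow> (real^3) set \<Rightarrow> bool" where
  "trapping_set \<kappa> x y S \<longleftrightarrow>
     compact S \<and> connected S \<and> arcs_in \<kappa> x y S \<noteq> {} \<and>
     (\<forall>\<beta>\<in>arcs_in \<kappa> x y S.
        inj_on (snd \<beta>) {0..fst \<beta>} \<and>
        (\<forall>\<gamma>\<in>arcs_not_in \<kappa> x y S. \<not> constrained_homotopic \<kappa> x y \<beta> \<gamma>))"

definition trapped_region :: "real \<Rightarrow> real^3 \<Rightarrow> real^3 \<Rightarrow> (real^3) set \<Rightarrow> bool" where
  "trapped_region \<kappa> x y S \<longleftrightarrow>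
     trapping_set \<kappa> x y S \<and> (\<forall>S'. trapping_set \<kappa> x y S' \<and> S' \<subseteq> S \<longrightarrow> S' = S)"

lemma rescale_has_vector_derivative:
  assumes "C1_curve s \<gamma>" "u \<in> {0..1}"
  shows "(rescale (s, \<gamma>) has_vector_derivative s *\<^sub>R velocity s \<gamma> (s * u)) (at u within {0..1})"
proof -
  have s: "0 < s" using assms by (simp add: C1_curve_def)
  have img: "(\<lambda>u. s * u) ` {0..1} = {0..s}"
    using s image_mult_atLeastAtMost[of s 0 1] by simp
  have su: "s * u \<in> {0..s}" using img assms(2) by blast
  then have "\<gamma> differentiable (at (s * u) within {0..s})"
    using assms(1) by (simp add: C1_curve_def)
  then have "(\<gamma> has_vector_derivative velocity s \<gamma> (s * u)) (at (s * u) within (\<lambda>u. s * u) ` {0..1})"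
    unfolding img velocity_def by (simp add: vector_derivative_works)
  moreover have "((\<lambda>u. s * u) has_vector_derivative s) (at u within {0..1})"
    by (auto intro!: derivative_eq_intros simp: has_real_derivative_iff_has_vector_derivative[symmetric])
  ultimately have "(\<gamma> \<circ> (\<lambda>u. s * u) has_vector_derivative s *\<^sub>R velocity s \<gamma> (s * u)) (at u within {0..1})"
    by (intro vector_diff_chain_within)
  then show ?thesis by (simp add: rescale_def[abs_def] comp_def)
qed

lemma rescale_deriv_eq:
  assumes "C1_curve s \<gamma>" "u \<in> {0..1}"
  shows "rescale_deriv (s, \<gamma>) u = s *\<^sub>R velocity s \<gamma> (s * u)"
  unfolding rescale_deriv_def
  using rescale_has_vector_derivative[OF assms] assms(2)
  by (intro vector_derivative_within) (auto simp: trivial_limit_within islimpt_Icc)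

lemma continuous_on_rescale:
  assumes "C1_curve (fst a) (snd a)"
  shows "continuous_on {0..1} (rescale a)" "continuous_on {0..1} (rescale_deriv a)"
proof -
  obtain s \<gamma> where a: "a = (s, \<gamma>)" by (cases a)
  have C: "C1_curve s \<gamma>" using assms a by simp
  show "continuous_on {0..1} (rescale a)"
    unfolding a continuous_on_eq_continuous_within
    using rescale_has_vector_derivative[OF C] has_vector_derivative_continuous by blast
  have s: "0 < s" and v: "continuous_on {0..s} (velocity s \<gamma>)"
    using C by (auto simp: C1_curve_def)
  have "continuous_on {0..1} (\<lambda>u. s *\<^sub>R velocity s \<gamma> (s * u))"
    using s by (intro continuous_intros continuous_on_compose2[OF v]) (auto simp: mult_left_le)
  then show "continuous_on {0..1} (rescale_deriv a)"
    by (rule continuous_on_eq) (simp add: a rescale_deriv_eq[OF C])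
qed

lemma sup_norm_facts:
  fixes f :: "real \<Rightarrow> real^3"
  assumes "continuous_on {0..1} f"
  shows "bdd_above ((\<lambda>u. norm (f u)) ` {0..1})"
    and "u \<in> {0..1} \<Longrightarrow> norm (f u) \<le> (SUP u\<in>{0..1}. norm (f u))"
    and "0 \<le> (SUP u\<in>{0..1}. norm (f u))"
proof -
  have "compact ((\<lambda>u. norm (f u)) ` {0..1})"
    by (intro compact_continuous_image continuous_intros assms) auto
  then show b: "bdd_above ((\<lambda>u. norm (f u)) ` {0..1})"
    by (intro bounded_imp_bdd_above compact_imp_bounded)
  show *: "norm (f u) \<le> (SUP u\<in>{0..1}. norm (f u))" if "u \<in> {0..1}" for u
    using b that by (intro cSUP_upper)
  show "0 \<le> (SUP u\<in>{0..1}. norm (f u))"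
    using order_trans[OF norm_ge_zero *[of 0]] by simp
qed

lemma sup_norm_triangle:
  fixes f g h :: "real \<Rightarrow> real^3"
  assumes "continuous_on {0..1} f" "continuous_on {0..1} g" "continuous_on {0..1} h"
  shows "(SUP u\<in>{0..1}. norm (f u - h u)) \<le>
         (SUP u\<in>{0..1}. norm (f u - g u)) + (SUP u\<in>{0..1}. norm (g u - h u))"
proof (rule cSUP_least)
  fix u :: real assume u: "u \<in> {0..1}"
  have "norm (f u - h u) \<le> norm (f u - g u) + norm (g u - h u)"
    by (rule norm_triangle_ineq4[of "f u - g u" "h u - g u", simplified, THEN order_trans])
       (simp add: norm_minus_commute)
  also have "\<dots> \<le> (SUP u\<in>{0..1}. norm (f u - g u)) + (SUP u\<in>{0..1}. norm (g u - h u))"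
    using u assms by (intro add_mono sup_norm_facts(2) continuous_intros)
  finally show "norm (f u - h u) \<le>
     (SUP u\<in>{0..1}. norm (f u - g u)) + (SUP u\<in>{0..1}. norm (g u - h u))" .
qed auto

lemma C1_dist_nonneg: "0 \<le> C1_dist a b"
  unfolding C1_dist_def
  by (auto intro!: add_nonneg_nonneg sup_norm_facts(3) continuous_on_diff continuous_on_rescale)

lemma C1_dist_eq_0_imp_eq:
  assumes a: "a \<in> constrained_arcs \<kappa> x y" and b: "b \<in> constrained_arcs \<kappa> x y"
    and d: "C1_dist a b = 0"
  shows "a = b"
proof -
  obtain s \<beta> t \<gamma> where ab: "a = (s, \<beta>)" "b = (t, \<gamma>)" by (cases a, cases b)
  have C: "C1_curve s \<beta>" "C1_curve t \<gamma>" "norm (velocity s \<beta> 0) = 1" "norm (velocity t \<gamma> 0) = 1"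
    using a b by (auto simp: ab constrained_arcs_def constrained_arc_def C1_curve_def)
  have pos: "0 < s" "0 < t" using C by (auto simp: C1_curve_def)
  have c: "continuous_on {0..1} (\<lambda>u. rescale a u - rescale b u)"
    "continuous_on {0..1} (\<lambda>u. rescale_deriv a u - rescale_deriv b u)"
    using C by (auto intro!: continuous_on_diff continuous_on_rescale simp: ab)
  have "(SUP u\<in>{0..1}. norm (rescale a u - rescale b u)) = 0 \<and>
        (SUP u\<in>{0..1}. norm (rescale_deriv a u - rescale_deriv b u)) = 0"
    using d C sup_norm_facts(3)[OF c(1)] sup_norm_facts(3)[OF c(2)]
    by (simp add: C1_dist_def ab)
  then have eq: "rescale a u = rescale b u" "rescale_deriv a u = rescale_deriv b u" if "u \<in> {0..1}" for u
    using sup_norm_facts(2)[OF c(1) that] sup_norm_facts(2)[OF c(2) that] by auto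
  have "s *\<^sub>R velocity s \<beta> 0 = t *\<^sub>R velocity t \<gamma> 0"
    using eq(2)[of 0] rescale_deriv_eq[OF C(1), of 0] rescale_deriv_eq[OF C(2), of 0] by (simp add: ab)
  then have "norm (s *\<^sub>R velocity s \<beta> 0) = norm (t *\<^sub>R velocity t \<gamma> 0)" by simp
  then have st: "s = t" using C pos by simp
  have "\<beta> r = \<gamma> r" for r
  proof (cases "r \<in> {0..s}")
    case True
    then show ?thesis using eq(1)[of "r / s"] pos st by (simp add: ab rescale_def)
  next
    case False
    then show ?thesis using C st by (simp add: C1_curve_def extensional_def)
  qed
  then show ?thesis using st by (auto simp: ab)
qed

lemma Metric_space_constrained_arcs: "Metric_space (constrained_arcs \<kappa> x y) C1_dist"
proof
  have C1: "C1_curve (fst a) (snd a)" if "a \<in> constrained_arcs \<kappa> x y" for a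
    using that by (auto simp: constrained_arcs_def constrained_arc_def)
  show "0 \<le> C1_dist a b" for a b
    by (rule C1_dist_nonneg)
  show "C1_dist a b = C1_dist b a" for a b
    by (simp add: C1_dist_def norm_minus_commute)
  show "C1_dist a b = 0 \<longleftrightarrow> a = b" if "a \<in> constrained_arcs \<kappa> x y" "b \<in> constrained_arcs \<kappa> x y" for a b
    using C1_dist_eq_0_imp_eq[OF that] by (auto simp: C1_dist_def)
  show "C1_dist a c \<le> C1_dist a b + C1_dist b c"
    if "a \<in> constrained_arcs \<kappa> x y" "b \<in> constrained_arcs \<kappa> x y" "c \<in> constrained_arcs \<kappa> x y" for a b c
    using that[THEN C1]
      sup_norm_triangle[of "rescale a" "rescale b" "rescale c"]
      sup_norm_triangle[of "rescale_deriv a" "rescale_deriv b" "rescale_deriv c"]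
    by (simp add: C1_dist_def continuous_on_rescale)
qed

lemma topspace_arc_space [simp]: "topspace (arc_space \<kappa> x y) = constrained_arcs \<kappa> x y"
  by (simp add: arc_space_def Metric_space.topspace_mtopology[OF Metric_space_constrained_arcs])

lemma constrained_homotopic_eq: "constrained_homotopic \<kappa> x y = path_component_of (arc_space \<kappa> x y)"
  by (simp add: fun_eq_iff constrained_homotopic_def path_component_of_def)

end

theory Submission
  imports Defs
begin

text \<open>
  Put \<open>r = 1 / \<kappa>\<close>. The closed region is the \<^emph>\<open>spindle\<close> of \<open>x\<close> and \<open>y\<close>, the intersection of all balls
  of radius \<open>r\<close> whose boundary contains both points: the short arcs sweep out the frontier of this
  compact convex set (\<open>closure_inside_short_arcs\<close>).

  What separates the two kinds of arcs is their length. The tangent of a \<open>\<kappa>\<close>-constrained arc is a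
  \<open>\<kappa>\<close>-Lipschitz curve in the unit sphere, so along a piece of length \<open>l \<le> \<pi> r\<close> it turns by an angle of
  at most \<open>\<kappa> l\<close> (\<open>tangent_angle\<close>). Comparison with a circle of radius \<open>r\<close> gives two facts. A piece of
  length \<open>\<pi> r\<close> has its ends at distance at least \<open>2 r\<close> (\<open>long_curve_has_distant_points\<close>), but the
  spindle has diameter \<open>dist x y < 2 r\<close>; so an arc of length at least \<open>\<pi> r\<close> is not in the spindle, and no
  arc from \<open>x\<close> to \<open>y\<close> has length exactly \<open>\<pi> r\<close>. An arc shorter than \<open>\<pi> r\<close> cannot leave a ball of radius
  \<open>r\<close> and come back (\<open>short_curve_in_ball\<close>), so it is in the spindle. Hence an arc is in the spindle if
  and only if its length is less than \<open>\<pi> r\<close> (\<open>arc_in_spindle_iff\<close>). The length is continuous in the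
  \<open>C\<^sup>1\<close> metric and omits the value \<open>\<pi> r\<close>, so a homotopy cannot cross it (\<open>homotopic_length_less\<close>).

  For minimality, every short arc is homotopic to the segment from \<open>x\<close> to \<open>y\<close>
  (\<open>short_arc_homotopic_to_segment\<close>): zoom in on ever smaller initial pieces, enlarged so that their
  ends stay at \<open>x\<close> and \<open>y\<close>. A trapping set inside the spindle contains some short arc, hence all
  of them, and the short arcs cover the spindle (\<open>spindle_covered_by_short_arcs\<close>).
\<close>

section \<open>Unit speed curves with Lipschitz tangent\<close>

text \<open>
  The triangle inequality for the angular distance on the unit sphere. It is Cauchy--Schwarz for the
  components of \<open>a\<close> and \<open>c\<close> orthogonal to \<open>b\<close>.
\<close>

lemma arccos_inner_triangle:
  fixes a b c :: "'a::real_inner"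
  assumes "norm a = 1" "norm b = 1" "norm c = 1"
  shows "arccos (a \<bullet> c) \<le> arccos (a \<bullet> b) + arccos (b \<bullet> c)"
proof (cases "arccos (a \<bullet> b) + arccos (b \<bullet> c) \<le> pi")
  case True
  have unit: "a \<bullet> a = 1" "b \<bullet> b = 1" "c \<bullet> c = 1"
    using assms by (simp_all add: dot_square_norm)
  have bounds: "\<bar>a \<bullet> b\<bar> \<le> 1" "\<bar>b \<bullet> c\<bar> \<le> 1" "\<bar>a \<bullet> c\<bar> \<le> 1"
    using assms Cauchy_Schwarz_ineq2[of a b] Cauchy_Schwarz_ineq2[of b c]
      Cauchy_Schwarz_ineq2[of a c] by simp_all
  let ?p = "a - (a \<bullet> b) *\<^sub>R b" and ?q = "c - (b \<bullet> c) *\<^sub>R b"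
  have norms: "norm ?p = sqrt (1 - (a \<bullet> b)\<^sup>2)" "norm ?q = sqrt (1 - (b \<bullet> c)\<^sup>2)"
    using unit by (simp_all add: norm_eq_sqrt_inner inner_diff_left inner_diff_right
        inner_commute power2_eq_square)
  have "?p \<bullet> ?q = a \<bullet> c - (a \<bullet> b) * (b \<bullet> c)"
    using unit by (simp add: inner_diff_left inner_diff_right inner_commute)
  moreover have "\<bar>?p \<bullet> ?q\<bar> \<le> norm ?p * norm ?q"
    by (rule Cauchy_Schwarz_ineq2)
  ultimately have "(a \<bullet> b) * (b \<bullet> c) - sqrt (1 - (a \<bullet> b)\<^sup>2) * sqrt (1 - (b \<bullet> c)\<^sup>2) \<le> a \<bullet> c"
    unfolding norms by linarith
  then have "cos (arccos (a \<bullet> b) + arccos (b \<bullet> c)) \<le> a \<bullet> c"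
    using bounds by (simp add: cos_add sin_arccos_abs)
  then have "arccos (a \<bullet> c) \<le> arccos (cos (arccos (a \<bullet> b) + arccos (b \<bullet> c)))"
    using bounds by (intro arccos_le_arccos) auto
  also have "\<dots> = arccos (a \<bullet> b) + arccos (b \<bullet> c)"
    using True bounds by (intro arccos_cos) (auto intro!: add_nonneg_nonneg arccos_lbound)
  finally show ?thesis .
next
  case False
  have "\<bar>a \<bullet> c\<bar> \<le> 1" using assms Cauchy_Schwarz_ineq2[of a c] by simp
  then have "arccos (a \<bullet> c) \<le> pi" by (intro arccos_ubound) auto
  then show ?thesis using False by linarith
qed

lemma arccos_inner_le_arcsin_chord:
  fixes p q :: "'a::real_inner"
  assumes "norm p = 1" "norm q = 1" "norm (p - q) \<le> \<delta>" "\<delta> \<le> 2"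
  shows "arccos (p \<bullet> q) \<le> 2 * arcsin (\<delta> / 2)"
proof -
  have d0: "0 \<le> \<delta>" using assms(3) norm_ge_zero[of "p - q"] by linarith
  have "(norm (p - q))\<^sup>2 = 2 - 2 * (p \<bullet> q)"
    using assms(1,2) by (simp add: power2_norm_eq_inner inner_diff_left inner_diff_right
        inner_commute norm_eq_1)
  moreover have "(norm (p - q))\<^sup>2 \<le> \<delta>\<^sup>2" using assms(3) by (intro power_mono) auto
  moreover have "cos (2 * arcsin (\<delta> / 2)) = 1 - \<delta>\<^sup>2 / 2"
    using d0 assms(4) by (subst cos_double_sin) (simp add: power_divide)
  ultimately have "cos (2 * arcsin (\<delta> / 2)) \<le> p \<bullet> q" by linarith
  moreover have "p \<bullet> q \<le> 1"
    using assms Cauchy_Schwarz_ineq2[of p q] by simp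
  ultimately have "arccos (p \<bullet> q) \<le> arccos (cos (2 * arcsin (\<delta> / 2)))"
    by (intro arccos_le_arccos) auto
  also have "\<dots> = 2 * arcsin (\<delta> / 2)"
  proof (rule arccos_cos)
    have "arcsin 0 \<le> arcsin (\<delta> / 2)" using d0 assms(4) by (intro arcsin_le_arcsin) auto
    then show "0 \<le> 2 * arcsin (\<delta> / 2)" by simp
    show "2 * arcsin (\<delta> / 2) \<le> pi" using d0 assms(4) arcsin_ubound[of "\<delta>/2"] by linarith
  qed
  finally show ?thesis .
qed

lemma Bessel_two:
  fixes N M z :: "'a::real_inner"
  assumes "norm N = 1" "norm M = 1" "N \<bullet> M = 0"
  shows "(z \<bullet> N)\<^sup>2 + (z \<bullet> M)\<^sup>2 \<le> (norm z)\<^sup>2"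
proof -
  have *: "N \<bullet> N = 1" "M \<bullet> M = 1" "M \<bullet> N = 0" "N \<bullet> z = z \<bullet> N" "M \<bullet> z = z \<bullet> M"
    using assms by (simp_all add: norm_eq_1 inner_commute)
  let ?w = "z - (z \<bullet> N) *\<^sub>R N - (z \<bullet> M) *\<^sub>R M"
  have "0 \<le> ?w \<bullet> ?w" by simp
  also have "?w \<bullet> ?w = z \<bullet> z - (z \<bullet> N)\<^sup>2 - (z \<bullet> M)\<^sup>2"
    unfolding inner_diff_left inner_diff_right inner_scaleR_left inner_scaleR_right * assms(3)
    by (simp add: power2_eq_square)
  finally show ?thesis by (simp add: power2_norm_eq_inner)
qed

text \<open>
  The comparison with a circle needs the curvature bound only in the form of a Lipschitz condition on
  the tangent, so that the points without curvature need no separate treatment.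
\<close>

locale unit_speed_curve =
  fixes \<kappa> s :: real and \<gamma> T :: "real \<Rightarrow> 'a::real_inner"
  assumes curvature_pos: "0 < \<kappa>"
    and length_pos: "0 < s"
    and has_tangent: "t \<in> {0..s} \<Longrightarrow> (\<gamma> has_vector_derivative T t) (at t within {0..s})"
    and unit_tangent: "t \<in> {0..s} \<Longrightarrow> norm (T t) = 1"
    and tangent_Lipschitz:
      "t \<in> {0..s} \<Longrightarrow> u \<in> {0..s} \<Longrightarrow> norm (T t - T u) \<le> \<kappa> * \<bar>t - u\<bar>"
begin

text \<open>
  Cut \<open>[a, b]\<close> into \<open>n\<close> equal pieces. On each of them the Lipschitz condition bounds the chord of the
  tangent curve, hence its angle, and the angles add up. The bound \<open>\<kappa> (b - a)\<close> is the limit for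
  \<open>n \<rightarrow> \<infinity>\<close>, where the difference between chord and angle disappears.
\<close>

lemma tangent_angle:
  assumes "a \<in> {0..s}" "b \<in> {0..s}" "a \<le> b"
  shows "arccos (T a \<bullet> T b) \<le> \<kappa> * (b - a)"
proof -
  define w where "w = \<kappa> * (b - a)"
  have w: "0 \<le> w" using curvature_pos assms by (simp add: w_def)
  have step: "arccos (T a \<bullet> T b) \<le> real n * (2 * arcsin (w / real n / 2))"
    if n: "0 < n" "w / real n \<le> 2" for n :: nat
  proof -
    define h where "h = (b - a) / real n"
    have h: "0 \<le> h" "real n * h = b - a" using n assms by (auto simp: h_def)
    have mem: "a + real k * h \<in> {0..s}" if "k \<le> n" for k
    proof -
      have "real k * h \<le> real n * h" using that h by (intro mult_right_mono) auto
      then show ?thesis using h assms by simp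
    qed
    have "arccos (T a \<bullet> T (a + real k * h)) \<le> real k * (2 * arcsin (w / real n / 2))" if "k \<le> n" for k
      using that
    proof (induction k)
      case 0
      then show ?case using unit_tangent[OF assms(1)] by (simp add: dot_square_norm)
    next
      case (Suc k)
      let ?p = "T (a + real k * h)" and ?q = "T (a + real (Suc k) * h)"
      have mm: "a + real k * h \<in> {0..s}" "a + real (Suc k) * h \<in> {0..s}"
        using mem Suc.prems Suc_leD by blast+
      have "norm (?p - ?q) \<le> \<kappa> * \<bar>(a + real k * h) - (a + real (Suc k) * h)\<bar>"
        using tangent_Lipschitz mm by blast
      also have "\<dots> = w / real n"
      proof -
        have "(a + real k * h) - (a + real (Suc k) * h) = - h" by (simp add: algebra_simps)
        then have "\<bar>(a + real k * h) - (a + real (Suc k) * h)\<bar> = h" using h by (simp only: abs_minus_cancel abs_of_nonneg)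
        then show ?thesis by (simp add: w_def h_def)
      qed
      finally have "arccos (?p \<bullet> ?q) \<le> 2 * arcsin (w / real n / 2)"
        using n mm unit_tangent by (intro arccos_inner_le_arcsin_chord) auto
      moreover have "arccos (T a \<bullet> ?q) \<le> arccos (T a \<bullet> ?p) + arccos (?p \<bullet> ?q)"
        using mm unit_tangent assms by (intro arccos_inner_triangle) auto
      ultimately show ?case using Suc by (simp add: algebra_simps)
    qed
    from this[of n] show ?thesis using h by simp
  qed
  have w_n: "(\<lambda>n. w / real n) \<longlonglongrightarrow> 0" by (rule lim_const_over_n)
  have "(\<lambda>n. real n * (2 * arcsin (w / real n / 2))) \<longlonglongrightarrow> w"
  proof (cases "w = 0")
    case False
    have "DERIV arcsin 0 :> 1"
      using DERIV_arcsin[of 0] by simp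
    then have "(\<lambda>h. arcsin h / h) \<midarrow>0\<rightarrow> 1" by (simp add: DERIV_def)
    moreover have "filterlim (\<lambda>n. w / real n / 2) (at 0) sequentially"
      unfolding filterlim_at using False tendsto_divide[OF w_n tendsto_const[of 2]]
      by (auto intro!: eventually_mono[OF eventually_gt_at_top[of 0]])
    ultimately have "(\<lambda>n. arcsin (w / real n / 2) / (w / real n / 2)) \<longlonglongrightarrow> 1"
      by (rule filterlim_compose)
    from tendsto_mult_left[OF this, of w]
    have "(\<lambda>n. w * (arcsin (w / real n / 2) / (w / real n / 2))) \<longlonglongrightarrow> w" by simp
    then show ?thesis using False by (simp add: mult_ac)
  qed simp
  moreover have "\<forall>\<^sub>F n in sequentially. arccos (T a \<bullet> T b) \<le> real n * (2 * arcsin (w / real n / 2))"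
  proof -
    have "\<forall>\<^sub>F n in sequentially. w / real n < 2"
      using w_n by (rule order_tendstoD) simp
    then show ?thesis using eventually_gt_at_top[of 0]
      by eventually_elim (intro step, auto)
  qed
  ultimately show ?thesis
    unfolding w_def by (intro tendsto_lowerbound[OF _ _ sequentially_bot]) (auto simp: w_def)
qed

lemma tangent_inner_ge:
  assumes "a \<in> {0..s}" "b \<in> {0..s}" "\<bar>b - a\<bar> \<le> pi / \<kappa>"
  shows "cos (\<kappa> * (b - a)) \<le> T a \<bullet> T b"
proof -
  have *: "cos (\<kappa> * (v - u)) \<le> T u \<bullet> T v"
    if "u \<in> {0..s}" "v \<in> {0..s}" "u \<le> v" "v - u \<le> pi / \<kappa>" for u v
  proof -
    have "\<bar>T u \<bullet> T v\<bar> \<le> 1"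
      using Cauchy_Schwarz_ineq2[of "T u" "T v"] unit_tangent that by simp
    then have "cos (arccos (T u \<bullet> T v)) = T u \<bullet> T v" "0 \<le> arccos (T u \<bullet> T v)"
      by (auto intro: arccos_lbound)
    moreover have "\<kappa> * (v - u) \<le> pi" using that curvature_pos by (simp add: field_simps)
    ultimately show ?thesis
      using tangent_angle[OF that(1-3)] cos_monotone_0_pi_le by metis
  qed
  show ?thesis
  proof (cases "a \<le> b")
    case False
    then have "cos (\<kappa> * (a - b)) \<le> T b \<bullet> T a" using assms by (intro *) auto
    moreover have "cos (\<kappa> * (a - b)) = cos (\<kappa> * (b - a))"
      using cos_minus[of "\<kappa> * (b - a)"] by (simp add: algebra_simps)
    ultimately show ?thesis by (simp add: inner_commute)
  qed (use * assms in auto)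
qed

lemma inner_curve_has_derivative:
  assumes "t \<in> {0<..<s}"
  shows "((\<lambda>t. \<gamma> t \<bullet> v) has_real_derivative T t \<bullet> v) (at t)"
proof -
  have "(\<gamma> has_vector_derivative T t) (at t)"
    using has_tangent[of t] assms at_within_Icc_at[of 0 t s] by simp
  from bounded_linear.has_vector_derivative[OF bounded_linear_inner_left this]
  show ?thesis by (simp add: has_real_derivative_iff_has_vector_derivative)
qed

lemma continuous_curve: "continuous_on {0..s} \<gamma>"
  using has_tangent has_vector_derivative_continuous continuous_on_eq_continuous_within by blast

lemma continuous_tangent: "continuous_on {0..s} T"
proof (rule lipschitz_on_continuous_on)
  show "\<kappa>-lipschitz_on {0..s} T"
    using tangent_Lipschitz curvature_pos by (intro lipschitz_onI) (auto simp: dist_norm)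
qed

text \<open>
  The integral of \<open>tangent_inner_ge\<close>; equality holds for the circle of radius \<open>1 / \<kappa>\<close>.
\<close>

lemma displacement_along_tangent:
  assumes "t0 \<in> {0..s}" "0 \<le> a" "a \<le> b" "b \<le> s" "\<bar>a - t0\<bar> \<le> pi / \<kappa>" "\<bar>b - t0\<bar> \<le> pi / \<kappa>"
  shows "(sin (\<kappa> * (b - t0)) - sin (\<kappa> * (a - t0))) / \<kappa> \<le> (\<gamma> b - \<gamma> a) \<bullet> T t0"
proof -
  define g where "g t = \<gamma> t \<bullet> T t0 - sin (\<kappa> * (t - t0)) / \<kappa>" for t
  have "g a \<le> g b"
  proof (rule DERIV_nonneg_imp_increasing_open[OF assms(3)])
    fix t assume t: "a < t" "t < b"
    have "(g has_real_derivative T t \<bullet> T t0 - cos (\<kappa> * (t - t0))) (at t)"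
      unfolding g_def[abs_def]
      by (rule derivative_eq_intros inner_curve_has_derivative refl | use t assms curvature_pos in force)+
    moreover have "cos (\<kappa> * (t - t0)) \<le> T t0 \<bullet> T t"
      using t assms by (intro tangent_inner_ge) auto
    ultimately show "\<exists>y. (g has_real_derivative y) (at t) \<and> 0 \<le> y"
      by (auto simp: inner_commute)
  next
    show "continuous_on {a..b} g"
      unfolding g_def[abs_def] using assms curvature_pos
      by (intro continuous_intros continuous_on_subset[OF continuous_curve]) auto
  qed
  then show ?thesis by (simp add: g_def inner_diff_left diff_divide_distrib)
qed

text \<open>
  A tangent at angle at most \<open>\<kappa> \<bar>t - t0\<bar> \<le> \<pi> / 2\<close> from \<open>T t0\<close> has a component of size at most
  \<open>sin (\<kappa> \<bar>t - t0\<bar>)\<close> in any direction orthogonal to \<open>T t0\<close>; this is integrated.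
\<close>

lemma displacement_along_normal:
  assumes t0: "t0 \<in> {0..s}" and t: "t \<in> {0..s}" "\<bar>t - t0\<bar> \<le> pi / (2 * \<kappa>)"
    and N: "norm N = 1" "N \<bullet> T t0 = 0"
  shows "(cos (\<kappa> * (t - t0)) - 1) / \<kappa> \<le> (\<gamma> t - \<gamma> t0) \<bullet> N"
proof -
  have TN: "\<bar>T u \<bullet> N\<bar> \<le> sin (\<kappa> * \<bar>u - t0\<bar>)" if u: "u \<in> {0..s}" "\<bar>u - t0\<bar> \<le> pi / (2 * \<kappa>)" for u
  proof -
    have ang: "0 \<le> \<kappa> * \<bar>u - t0\<bar>" "\<kappa> * \<bar>u - t0\<bar> \<le> pi / 2"
      using u curvature_pos by (auto simp: field_simps)
    have "\<bar>u - t0\<bar> \<le> pi / \<kappa>"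
      using u(2) curvature_pos by (simp add: field_simps) (use pi_gt_zero in linarith)
    then have "cos (\<kappa> * (u - t0)) \<le> T t0 \<bullet> T u" using u t0 by (intro tangent_inner_ge) auto
    moreover have "cos (\<kappa> * (u - t0)) = cos (\<kappa> * \<bar>u - t0\<bar>)"
      using cos_abs_real[of "\<kappa> * (u - t0)"] curvature_pos by (simp add: abs_mult)
    ultimately have c: "cos (\<kappa> * \<bar>u - t0\<bar>) \<le> T u \<bullet> T t0" by (simp add: inner_commute)
    have c0: "0 \<le> cos (\<kappa> * \<bar>u - t0\<bar>)" using ang by (intro cos_ge_zero) auto
    let ?q = "T u - (T u \<bullet> T t0) *\<^sub>R T t0"
    have "T u \<bullet> N = ?q \<bullet> N" using N by (simp add: inner_diff_left inner_diff_right inner_commute)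
    then have "\<bar>T u \<bullet> N\<bar> \<le> norm ?q" using Cauchy_Schwarz_ineq2[of ?q N] N by simp
    then have "\<bar>T u \<bullet> N\<bar>\<^sup>2 \<le> (norm ?q)\<^sup>2" by (intro power_mono) auto
    also have "\<dots> = 1 - (T u \<bullet> T t0)\<^sup>2"
      using unit_tangent[OF u(1)] unit_tangent[OF t0] unfolding power2_norm_eq_inner
      by (simp add: inner_diff_left inner_diff_right inner_commute
          norm_eq_1 power2_eq_square)
    also have "\<dots> \<le> 1 - (cos (\<kappa> * \<bar>u - t0\<bar>))\<^sup>2" using power_mono[OF c c0, of 2] by simp
    also have "\<dots> = (sin (\<kappa> * \<bar>u - t0\<bar>))\<^sup>2" by (simp add: sin_squared_eq)
    finally show ?thesis
    proof (rule power2_le_imp_le)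
      show "0 \<le> sin (\<kappa> * \<bar>u - t0\<bar>)" using ang by (intro sin_ge_zero) simp_all
    qed
  qed
  define g where "g t = \<gamma> t \<bullet> N - cos (\<kappa> * (t - t0)) / \<kappa>" for t
  have der: "(g has_real_derivative T u \<bullet> N + sin (\<kappa> * (u - t0))) (at u)" if "u \<in> {0<..<s}" for u
    unfolding g_def[abs_def]
    by (rule derivative_eq_intros inner_curve_has_derivative refl | use that curvature_pos in force)+
  have cont: "continuous_on {a..b} g" if "0 \<le> a" "b \<le> s" for a b
    unfolding g_def[abs_def] using that curvature_pos
    by (intro continuous_intros continuous_on_subset[OF continuous_curve]) auto
  have "g t0 \<le> g t"
  proof (cases "t0 \<le> t")
    case True
    show ?thesis
    proof (rule DERIV_nonneg_imp_increasing_open[OF True])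
      fix u assume u: "t0 < u" "u < t"
      then have "0 \<le> T u \<bullet> N + sin (\<kappa> * (u - t0))" using TN[of u] t t0 by auto
      then show "\<exists>y. (g has_real_derivative y) (at u) \<and> 0 \<le> y"
        using der[of u] u t t0 by auto
    qed (use cont t t0 in auto)
  next
    case False
    then have le: "t \<le> t0" by simp
    show ?thesis
    proof (rule DERIV_nonpos_imp_decreasing_open[OF le])
      fix u assume u: "t < u" "u < t0"
      have "sin (\<kappa> * (u - t0)) = - sin (\<kappa> * \<bar>u - t0\<bar>)"
        using u sin_minus[of "\<kappa> * (t0 - u)"] by (simp add: algebra_simps)
      then have "T u \<bullet> N + sin (\<kappa> * (u - t0)) \<le> 0" using TN[of u] t t0 u by auto
      then show "\<exists>y. (g has_real_derivative y) (at u) \<and> y \<le> 0"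
        using der[of u] u t t0 by auto
    qed (use cont t t0 in auto)
  qed
  then show ?thesis by (simp add: g_def inner_diff_left diff_divide_distrib)
qed

text \<open>
  Project to the tangent at the middle of the piece, so that each half turns by at most
  \<open>\<kappa> (b - a) / 2 \<le> \<pi>\<close>. For a circular arc of radius \<open>1 / \<kappa>\<close> this is an equality.
\<close>

lemma chord_ge:
  assumes "0 \<le> a" "a \<le> b" "b \<le> s" "b - a \<le> 2 * pi / \<kappa>"
  shows "2 * sin (\<kappa> * (b - a) / 2) / \<kappa> \<le> norm (\<gamma> b - \<gamma> a)"
proof -
  define m where "m = (a + b) / 2"
  have m: "m \<in> {0..s}" using assms by (simp add: m_def)
  have eq: "b - m = (b - a) / 2" "a - m = - ((b - a) / 2)" by (simp_all add: m_def field_simps)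
  then have "\<bar>a - m\<bar> = (b - a) / 2" "\<bar>b - m\<bar> = (b - a) / 2"
    using assms(2) by simp_all
  moreover have "(b - a) / 2 \<le> pi / \<kappa>" using assms(4) curvature_pos by (simp add: field_simps)
  ultimately have "(sin (\<kappa> * (b - m)) - sin (\<kappa> * (a - m))) / \<kappa> \<le> (\<gamma> b - \<gamma> a) \<bullet> T m"
    by (intro displacement_along_tangent[OF m assms(1-3)]) linarith+
  then have "2 * sin (\<kappa> * (b - a) / 2) / \<kappa> \<le> (\<gamma> b - \<gamma> a) \<bullet> T m"
    unfolding eq by simp
  also have "\<dots> \<le> norm (\<gamma> b - \<gamma> a)"
    using norm_cauchy_schwarz[of "\<gamma> b - \<gamma> a" "T m"] unit_tangent[OF m] by simp
  finally show ?thesis .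
qed

lemma long_curve_has_distant_points:
  assumes "pi / \<kappa> \<le> s"
  shows "2 / \<kappa> \<le> norm (\<gamma> (pi / \<kappa>) - \<gamma> 0)"
  using chord_ge[of 0 "pi / \<kappa>"] assms curvature_pos
  by (simp add: divide_simps)

lemma displacement_inner_final_tangent:
  assumes "0 \<le> t" "t \<le> s" "t \<le> pi / \<kappa>"
  shows "0 \<le> (\<gamma> t - \<gamma> 0) \<bullet> T t"
proof -
  have "sin (\<kappa> * (0 - t)) = - sin (\<kappa> * t)" by simp
  moreover have "0 \<le> sin (\<kappa> * t)"
    using assms curvature_pos by (intro sin_ge_zero) (auto simp: field_simps)
  ultimately have "0 \<le> (sin (\<kappa> * (t - t)) - sin (\<kappa> * (0 - t))) / \<kappa>"
    using curvature_pos by simp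
  also have "\<dots> \<le> (\<gamma> t - \<gamma> 0) \<bullet> T t"
    using assms curvature_pos by (intro displacement_along_tangent) auto
  finally show ?thesis .
qed

lemma displacement_inner_initial_tangent:
  assumes "0 < t" "t \<le> s" "t < pi / \<kappa>"
  shows "0 < (\<gamma> t - \<gamma> 0) \<bullet> T 0"
proof -
  have "0 < sin (\<kappa> * t)"
    using assms curvature_pos by (intro sin_gt_zero) (auto simp: field_simps)
  then have "0 < (sin (\<kappa> * (t - 0)) - sin (\<kappa> * (0 - 0))) / \<kappa>"
    using curvature_pos by simp
  also have "\<dots> \<le> (\<gamma> t - \<gamma> 0) \<bullet> T 0"
    using assms curvature_pos by (intro displacement_along_tangent) auto
  finally show ?thesis .
qed

text \<open>
  The squared chord has derivative \<open>2 ((\<gamma> t - \<gamma> 0) \<bullet> T t)\<close>.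
\<close>

lemma chord_increasing:
  assumes "0 \<le> a" "a \<le> b" "b \<le> s" "b \<le> pi / \<kappa>"
  shows "norm (\<gamma> a - \<gamma> 0) \<le> norm (\<gamma> b - \<gamma> 0)"
proof -
  define g where "g t = (\<gamma> t - \<gamma> 0) \<bullet> (\<gamma> t - \<gamma> 0)" for t
  have "g a \<le> g b"
  proof (rule DERIV_nonneg_imp_increasing_open[OF assms(2)])
    fix t assume t: "a < t" "t < b"
    have "(\<gamma> has_vector_derivative T t) (at t)"
      using has_tangent[of t] t assms at_within_Icc_at[of 0 t s] by simp
    then have "((\<lambda>t. \<gamma> t - \<gamma> 0) has_derivative (\<lambda>h. h *\<^sub>R T t)) (at t)"
      unfolding has_vector_derivative_def by (auto intro!: derivative_eq_intros)
    from has_derivative_inner[OF this this]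
    have "(g has_real_derivative 2 * ((\<gamma> t - \<gamma> 0) \<bullet> T t)) (at t)"
      unfolding g_def[abs_def] has_field_derivative_def
      by (rule has_derivative_eq_rhs) (simp add: fun_eq_iff inner_commute)
    moreover have "0 \<le> (\<gamma> t - \<gamma> 0) \<bullet> T t"
      using t assms by (intro displacement_inner_final_tangent) auto
    ultimately show "\<exists>y. (g has_real_derivative y) (at t) \<and> 0 \<le> y" by auto
  next
    show "continuous_on {a..b} g"
      unfolding g_def[abs_def] using assms
      by (intro continuous_intros continuous_on_subset[OF continuous_curve]) auto
  qed
  then show ?thesis by (simp add: g_def norm_le)
qed

text \<open>
  At an inner point of the curve farthest from \<open>c\<close> the tangent is orthogonal to the radius. If the curve
  were outside the ball there, the shorter of its two halves, which turns by less than a right angle,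
  could not come back into the ball.
\<close>

lemma short_curve_in_ball:
  assumes short: "s < pi / \<kappa>" and ends: "dist c (\<gamma> 0) \<le> 1 / \<kappa>" "dist c (\<gamma> s) \<le> 1 / \<kappa>"
    and t: "t \<in> {0..s}"
  shows "dist c (\<gamma> t) \<le> 1 / \<kappa>"
proof -
  have "continuous_on {0..s} (\<lambda>t. dist c (\<gamma> t))"
    by (intro continuous_intros continuous_curve)
  then obtain t0 where t0: "t0 \<in> {0..s}"
    and max: "\<And>u. u \<in> {0..s} \<Longrightarrow> dist c (\<gamma> u) \<le> dist c (\<gamma> t0)"
    using continuous_attains_sup[of "{0..s}" "\<lambda>t. dist c (\<gamma> t)"] length_pos by auto
  have "dist c (\<gamma> t0) \<le> 1 / \<kappa>"
  proof (rule ccontr)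
    assume "\<not> dist c (\<gamma> t0) \<le> 1 / \<kappa>"
    then have out: "1 / \<kappa> < dist c (\<gamma> t0)" by simp
    define \<rho> where "\<rho> = dist c (\<gamma> t0)"
    define N where "N = (\<gamma> t0 - c) /\<^sub>R \<rho>"
    have \<rho>: "1 / \<kappa> < \<rho>" "0 < \<rho>"
      using out curvature_pos less_trans[of 0 "1 / \<kappa>" \<rho>] by (auto simp: \<rho>_def)
    have N1: "norm N = 1" using \<rho> by (simp add: N_def \<rho>_def dist_norm norm_minus_commute)
    have radial: "\<gamma> t0 - c = \<rho> *\<^sub>R N" using \<rho> by (simp add: N_def)
    have inner: "t0 \<in> {0<..<s}"
      using t0 out ends by (cases "t0 = 0"; cases "t0 = s"; auto)
    have NT: "N \<bullet> T t0 = 0"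
    proof -
      have "(\<gamma> has_vector_derivative T t0) (at t0)"
        using has_tangent[of t0] inner at_within_Icc_at[of 0 t0 s] by simp
      then have "((\<lambda>t. \<gamma> t - c) has_derivative (\<lambda>h. h *\<^sub>R T t0)) (at t0)"
        unfolding has_vector_derivative_def by (auto intro!: derivative_eq_intros)
      from has_derivative_inner[OF this this]
      have "((\<lambda>t. (\<gamma> t - c) \<bullet> (\<gamma> t - c)) has_real_derivative 2 * ((\<gamma> t0 - c) \<bullet> T t0)) (at t0)"
        unfolding has_field_derivative_def
        by (rule has_derivative_eq_rhs) (simp add: fun_eq_iff inner_commute)
      moreover have "0 < min t0 (s - t0)" using inner by auto
      moreover have "\<forall>u. \<bar>t0 - u\<bar> < min t0 (s - t0) \<longrightarrow>
          (\<gamma> u - c) \<bullet> (\<gamma> u - c) \<le> (\<gamma> t0 - c) \<bullet> (\<gamma> t0 - c)"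
      proof (intro allI impI)
        fix u assume "\<bar>t0 - u\<bar> < min t0 (s - t0)"
        then have "u \<in> {0..s}" by (auto simp: abs_less_iff)
        from max[OF this] show "(\<gamma> u - c) \<bullet> (\<gamma> u - c) \<le> (\<gamma> t0 - c) \<bullet> (\<gamma> t0 - c)"
          by (simp add: dist_norm norm_minus_commute norm_le[symmetric])
      qed
      ultimately have "2 * ((\<gamma> t0 - c) \<bullet> T t0) = 0" by (rule DERIV_local_max)
      then show ?thesis using \<rho> by (simp add: N_def)
    qed
    \<comment> \<open>\<open>u\<close> is the endpoint nearer to \<open>t0\<close>.\<close>
    obtain u where u: "u \<in> {0..s}" "u = 0 \<or> u = s" "\<bar>u - t0\<bar> < pi / (2 * \<kappa>)"
    proof (cases "t0 \<le> s / 2")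
      case True
      then show ?thesis using that[of 0] t0 short by (simp add: field_simps)
    next
      case False
      then show ?thesis using that[of s] t0 short by (simp add: field_simps)
    qed
    define \<theta> where "\<theta> = \<kappa> * (u - t0)"
    have "\<bar>\<theta>\<bar> = \<kappa> * \<bar>u - t0\<bar>" using curvature_pos by (simp add: \<theta>_def abs_mult)
    also have "\<dots> < \<kappa> * (pi / (2 * \<kappa>))" using u(3) curvature_pos by (rule mult_strict_left_mono)
    also have "\<dots> = pi / 2" using curvature_pos by simp
    finally have \<theta>: "- (pi / 2) < \<theta>" "\<theta> < pi / 2" by linarith+
    then have cos: "0 < cos \<theta>" by (rule cos_gt_zero_pi)
    define p where "p = (\<gamma> u - c) \<bullet> N"
    define q where "q = (\<gamma> u - c) \<bullet> T t0"
    have split: "\<gamma> u - c = (\<gamma> u - \<gamma> t0) + \<rho> *\<^sub>R N" using radial by (simp add: algebra_simps)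
    have "(cos \<theta> - 1) / \<kappa> \<le> (\<gamma> u - \<gamma> t0) \<bullet> N"
      unfolding \<theta>_def using u t0 N1 NT by (intro displacement_along_normal) auto
    moreover have "p = (\<gamma> u - \<gamma> t0) \<bullet> N + \<rho>"
      unfolding p_def split inner_add_left using N1 by (simp add: norm_eq_1)
    ultimately have p: "\<rho> - 1 / \<kappa> + cos \<theta> / \<kappa> \<le> p"
      by (simp add: diff_divide_distrib)
    have far: "\<bar>u - t0\<bar> \<le> pi / \<kappa>"
      using u(3) curvature_pos by (simp add: field_simps) (use pi_gt_zero in linarith)
    have q: "(sin \<theta> / \<kappa>)\<^sup>2 \<le> q\<^sup>2"
    proof -
      have q': "q = (\<gamma> u - \<gamma> t0) \<bullet> T t0" unfolding q_def split inner_add_left using NT by simp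
      have "\<bar>sin \<theta> / \<kappa>\<bar> \<le> \<bar>q\<bar>"
      proof (cases "t0 \<le> u")
        case True
        have "0 \<le> sin \<theta>"
          using True curvature_pos \<theta> by (intro sin_ge_zero) (simp_all add: \<theta>_def)
        moreover have "(sin (\<kappa> * (u - t0)) - sin (\<kappa> * (t0 - t0))) / \<kappa> \<le> (\<gamma> u - \<gamma> t0) \<bullet> T t0"
          using True t0 u far curvature_pos by (intro displacement_along_tangent) auto
        ultimately show ?thesis using curvature_pos by (simp add: q' \<theta>_def)
      next
        case False
        have "0 \<le> sin (- \<theta>)"
          using False curvature_pos \<theta>
          by (intro sin_ge_zero) (simp_all add: \<theta>_def mult_le_0_iff)
        moreover have "(sin (\<kappa> * (t0 - t0)) - sin (\<kappa> * (u - t0))) / \<kappa> \<le> (\<gamma> t0 - \<gamma> u) \<bullet> T t0"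
          using False t0 u far curvature_pos by (intro displacement_along_tangent) auto
        ultimately have "0 \<le> - sin \<theta> / \<kappa>" "- sin \<theta> / \<kappa> \<le> - q"
          using curvature_pos by (simp_all add: q' \<theta>_def inner_diff_left divide_le_0_iff)
        then show ?thesis by linarith
      qed
      then show ?thesis by (rule abs_le_square_iff[THEN iffD1])
    qed
    have "(1 / \<kappa>)\<^sup>2 = (cos \<theta> / \<kappa>)\<^sup>2 + (sin \<theta> / \<kappa>)\<^sup>2"
      unfolding power_divide add_divide_distrib[symmetric] by simp
    also have "\<dots> < p\<^sup>2 + q\<^sup>2"
    proof -
      have "cos \<theta> / \<kappa> < p" "0 \<le> cos \<theta> / \<kappa>" using p \<rho>(1) cos curvature_pos by simp_all
      then have "(cos \<theta> / \<kappa>)\<^sup>2 < p\<^sup>2" by (intro power_strict_mono) simp_all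
      with q show ?thesis by linarith
    qed
    also have "\<dots> \<le> (norm (\<gamma> u - c))\<^sup>2"
      unfolding p_def q_def using N1 unit_tangent[OF t0] NT by (rule Bessel_two)
    also have "\<dots> \<le> (1 / \<kappa>)\<^sup>2"
    proof -
      have "norm (\<gamma> u - c) \<le> 1 / \<kappa>"
        using u(2) ends unfolding dist_norm norm_minus_commute[of c] by blast
      then show ?thesis by (intro power_mono) simp_all
    qed
    finally show False by simp
  qed
  then show ?thesis using max[OF t] by simp
qed

end

section \<open>Constrained arcs\<close>

lemma norm_vector_derivative_le_Lipschitz:
  fixes f :: "real \<Rightarrow> 'a::real_normed_vector"
  assumes der: "(f has_vector_derivative D) (at t within S)" and nontrivial: "at t within S \<noteq> bot"
    and t: "t \<in> S" and lip: "\<And>u. u \<in> S \<Longrightarrow> norm (f u - f t) \<le> B * \<bar>u - t\<bar>"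
  shows "norm D \<le> B"
proof (rule tendsto_lowerbound)
  let ?q = "\<lambda>u. (1 / norm (u - t)) *\<^sub>R (f u - (f t + (u - t) *\<^sub>R D))"
  have "(?q \<longlongrightarrow> 0) (at t within S)"
    using der unfolding has_vector_derivative_def has_derivative_within by blast
  then have "((\<lambda>u. norm (?q u)) \<longlongrightarrow> 0) (at t within S)" by (rule tendsto_norm_zero)
  then show "((\<lambda>u. norm (?q u) + B) \<longlongrightarrow> B) (at t within S)"
    using tendsto_add[OF _ tendsto_const] by fastforce
  show "\<forall>\<^sub>F u in at t within S. norm D \<le> norm (?q u) + B"
    unfolding eventually_at_filter
  proof (rule always_eventually, intro allI impI)
    fix u assume u: "u \<noteq> t" "u \<in> S"
    have "\<bar>u - t\<bar> * norm D = norm ((u - t) *\<^sub>R D)" by simp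
    also have "\<dots> \<le> norm (f u - f t) + norm (f u - (f t + (u - t) *\<^sub>R D))"
      using norm_triangle_ineq4[of "f u - f t" "f u - (f t + (u - t) *\<^sub>R D)"]
      by (simp add: algebra_simps)
    also have "\<dots> \<le> B * \<bar>u - t\<bar> + norm (f u - (f t + (u - t) *\<^sub>R D))" using lip[OF u(2)] by simp
    finally have "\<bar>u - t\<bar> * norm D \<le> B * \<bar>u - t\<bar> + norm (f u - (f t + (u - t) *\<^sub>R D))" .
    then have "norm D \<le> (B * \<bar>u - t\<bar> + norm (f u - (f t + (u - t) *\<^sub>R D))) / \<bar>u - t\<bar>"
      using u(1) by (subst pos_le_divide_eq) (auto simp: mult.commute)
    also have "\<dots> = norm (?q u) + B"
      using u(1) by (simp add: add_divide_distrib)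
    finally show "norm D \<le> norm (?q u) + B" .
  qed
qed (rule nontrivial)

text \<open>
  The velocity is continuous, so off finitely many points it is the integral of the acceleration, which
  is bounded by \<open>\<kappa>\<close>.
\<close>

lemma constrained_arc_imp_unit_speed:
  assumes "0 < \<kappa>" and arc: "constrained_arc \<kappa> s \<gamma>"
  shows "unit_speed_curve \<kappa> s \<gamma> (velocity s \<gamma>)"
proof
  have C1: "C1_curve s \<gamma>" using arc by (simp add: constrained_arc_def)
  then show "0 < s" by (simp add: C1_curve_def)
  show "(\<gamma> has_vector_derivative velocity s \<gamma> t) (at t within {0..s})" if "t \<in> {0..s}" for t
    using C1 that unfolding velocity_def by (simp add: C1_curve_def vector_derivative_works)
  show "norm (velocity s \<gamma> t) = 1" if "t \<in> {0..s}" for t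
    using arc that by (simp add: constrained_arc_def)
  define V where "V = velocity s \<gamma>"
  obtain F A where F: "finite F" and A: "\<And>t. t \<in> {0..s} - F \<Longrightarrow> (V has_vector_derivative A t) (at t)"
    using arc unfolding constrained_arc_def piecewise_C1_differentiable_on_def
      C1_differentiable_on_def V_def by blast
  have cont: "continuous_on {0..s} V" using C1 by (simp add: C1_curve_def V_def)
  have bound: "norm (A t) \<le> \<kappa>" if t: "t \<in> {0..s} - F" for t
  proof -
    have d: "(V has_vector_derivative A t) (at t within {0..s})"
      using A[OF t] by (rule has_vector_derivative_at_within)
    then have "acceleration s \<gamma> t = A t"
      unfolding acceleration_def V_def[symmetric] using t \<open>0 < s\<close>
      by (intro vector_derivative_within_closed_interval) auto
    moreover have "velocity s \<gamma> differentiable (at t within {0..s})"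
      using d by (auto simp: V_def intro: differentiableI_vector)
    ultimately show ?thesis using arc t by (auto simp: constrained_arc_def)
  qed
  have *: "norm (V b - V a) \<le> \<kappa> * (b - a)" if "0 \<le> a" "a \<le> b" "b \<le> s" for a b
  proof -
    have "(A has_integral (V b - V a)) {a..b}"
      using that A by (intro fundamental_theorem_of_calculus_interior_strong[OF F]
          continuous_on_subset[OF cont]) auto
    from has_integral_bound_real[OF _ F this, of \<kappa>] show ?thesis
      using bound that \<open>0 < \<kappa>\<close> by simp
  qed
  show "norm (velocity s \<gamma> t - velocity s \<gamma> u) \<le> \<kappa> * \<bar>t - u\<bar>"
    if "t \<in> {0..s}" "u \<in> {0..s}" for t u
    using *[of u t] *[of t u] that
    by (cases "u \<le> t") (auto simp: V_def norm_minus_commute)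
qed (use assms in simp)

text \<open>
  The endpoints join the exceptional set because \<^const>\<open>piecewise_C1_differentiable_on\<close> refers to
  two-sided derivatives, and \<^const>\<open>velocity\<close> is an arbitrary value outside \<open>[0, s]\<close>.
\<close>

lemma constrained_arcI:
  fixes T :: "real \<Rightarrow> real^3"
  assumes curve: "unit_speed_curve \<kappa> s \<gamma> T" and ext: "\<gamma> \<in> extensional {0..s}"
    and inj: "inj_on \<gamma> {0..s}"
    and F: "finite F" and A: "\<And>t. t \<in> {0<..<s} - F \<Longrightarrow> (T has_vector_derivative A t) (at t)"
    and contA: "continuous_on ({0<..<s} - F) A"
  shows "constrained_arc \<kappa> s \<gamma>" and "\<And>t. t \<in> {0..s} \<Longrightarrow> velocity s \<gamma> t = T t"
proof -
  interpret unit_speed_curve \<kappa> s \<gamma> T by (rule curve)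
  show vel: "velocity s \<gamma> t = T t" if "t \<in> {0..s}" for t
    unfolding velocity_def using has_tangent that length_pos
    by (intro vector_derivative_within_closed_interval) auto
  have cont: "continuous_on {0..s} (velocity s \<gamma>)"
    using continuous_tangent by (rule continuous_on_eq) (simp add: vel)
  show "constrained_arc \<kappa> s \<gamma>"
    unfolding constrained_arc_def
  proof (intro conjI ballI impI)
    show "C1_curve s \<gamma>"
      unfolding C1_curve_def using length_pos ext has_tangent cont
      by (blast intro: differentiableI_vector)
    show "inj_on \<gamma> {0..s}" by (rule inj)
    show "\<gamma> 0 \<noteq> \<gamma> s" using inj length_pos by (auto dest: inj_onD)
    show "norm (velocity s \<gamma> t) = 1" if "t \<in> {0..s}" for t
      using that unit_tangent vel by simp
    have "(velocity s \<gamma> has_vector_derivative A t) (at t)" if t: "t \<in> {0<..<s} - F" for t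
      using A[OF t] by (rule has_vector_derivative_transform_within_open[of _ _ _ "{0<..<s}"])
        (use t vel in auto)
    moreover have "{0..s} - insert 0 (insert s F) = {0<..<s} - F" by auto
    ultimately have "velocity s \<gamma> C1_differentiable_on ({0..s} - insert 0 (insert s F))"
      unfolding C1_differentiable_on_def using contA by (auto intro!: exI[of _ A])
    then show "velocity s \<gamma> piecewise_C1_differentiable_on {0..s}"
      unfolding piecewise_C1_differentiable_on_def using cont F
      by (intro conjI exI[of _ "insert 0 (insert s F)"]) simp_all
    show "norm (acceleration s \<gamma> t) \<le> \<kappa>"
      if t: "t \<in> {0..s}" and d: "velocity s \<gamma> differentiable (at t within {0..s})" for t
    proof (rule norm_vector_derivative_le_Lipschitz)
      show "(velocity s \<gamma> has_vector_derivative acceleration s \<gamma> t) (at t within {0..s})"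
        using d by (simp add: acceleration_def vector_derivative_works)
      show "at t within {0..s} \<noteq> bot"
        using t length_pos by (simp add: trivial_limit_within islimpt_Icc)
      show "norm (velocity s \<gamma> u - velocity s \<gamma> t) \<le> \<kappa> * \<bar>u - t\<bar>" if "u \<in> {0..s}" for u
        using tangent_Lipschitz that t vel by simp
    qed (rule t)
  qed
qed

lemma constrained_arc_acceleration:
  assumes "constrained_arc \<kappa> s \<gamma>"
  obtains F A where "finite F"
    "\<And>t. t \<in> {0<..<s} - F \<Longrightarrow> (velocity s \<gamma> has_vector_derivative A t) (at t)"
    "continuous_on ({0<..<s} - F) A"
proof -
  obtain F A where "finite F"
    "\<And>t. t \<in> {0..s} - F \<Longrightarrow> (velocity s \<gamma> has_vector_derivative A t) (at t)"
    "continuous_on ({0..s} - F) A"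
    using assms unfolding constrained_arc_def piecewise_C1_differentiable_on_def
      C1_differentiable_on_def by blast
  then show ?thesis
    by (intro that[of F A]) (auto intro: continuous_on_subset)
qed

lemma constrained_arc_restrictI:
  fixes f T A :: "real \<Rightarrow> real^3"
  assumes "0 < \<kappa>" "0 < s"
    and f: "\<And>t. t \<in> {0..s} \<Longrightarrow> (f has_vector_derivative T t) (at t within {0..s})"
    and T: "\<And>t. t \<in> {0..s} \<Longrightarrow> norm (T t) = 1"
      "\<And>t u. t \<in> {0..s} \<Longrightarrow> u \<in> {0..s} \<Longrightarrow> norm (T t - T u) \<le> \<kappa> * \<bar>t - u\<bar>"
    and inj: "inj_on f {0..s}"
    and F: "finite F" "\<And>t. t \<in> {0<..<s} - F \<Longrightarrow> (T has_vector_derivative A t) (at t)"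
      "continuous_on ({0<..<s} - F) A"
  shows "constrained_arc \<kappa> s (restrict f {0..s})"
    and "\<And>t. t \<in> {0..s} \<Longrightarrow> velocity s (restrict f {0..s}) t = T t"
proof -
  have "unit_speed_curve \<kappa> s (restrict f {0..s}) T"
  proof
    show "(restrict f {0..s} has_vector_derivative T t) (at t within {0..s})"
      if "t \<in> {0..s}" for t
      using f[OF that] that by (rule has_vector_derivative_transform[rotated 2]) auto
  qed (use assms in auto)
  moreover have "inj_on (restrict f {0..s}) {0..s}" using inj by (simp add: inj_on_restrict_eq)
  ultimately show "constrained_arc \<kappa> s (restrict f {0..s})"
    and "\<And>t. t \<in> {0..s} \<Longrightarrow> velocity s (restrict f {0..s}) t = T t"
    using constrained_arcI[OF _ restrict_extensional _ F] by blast+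
qed

text \<open>
  The chord between two tangents at angle \<open>z\<close> is \<open>2 sin (z / 2)\<close>, at most \<open>z\<close>.
\<close>

lemma circular_constrained_arc:
  assumes "0 < \<kappa>" and R: "1 / \<kappa> \<le> R" and u: "norm u = 1" and v: "norm v = 1" and uv: "u \<bullet> v = 0"
    and \<alpha>: "0 < \<alpha>" "\<alpha> < 2 * pi"
  shows "constrained_arc \<kappa> (R * \<alpha>) (\<lambda>t\<in>{0..R * \<alpha>}. circle_point c u v R (t / R))"
proof (rule constrained_arc_restrictI)
  have "0 < 1 / \<kappa>" using \<open>0 < \<kappa>\<close> by simp
  then have Rpos: "0 < R" using R by linarith
  then show "0 < R * \<alpha>" using \<alpha> by simp
  define T where "T t = - sin (t / R) *\<^sub>R u + cos (t / R) *\<^sub>R v" for t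
  define A where "A t = - (cos (t / R) / R) *\<^sub>R u - (sin (t / R) / R) *\<^sub>R v" for t
  show "((\<lambda>t. circle_point c u v R (t / R)) has_vector_derivative T t) (at t within {0..R * \<alpha>})" for t
  proof -
    have "((\<lambda>t. R * cos (t / R)) has_real_derivative - sin (t / R)) (at t within {0..R * \<alpha>})"
      "((\<lambda>t. R * sin (t / R)) has_real_derivative cos (t / R)) (at t within {0..R * \<alpha>})"
      by (rule derivative_eq_intros refl | use Rpos in simp)+
    from has_vector_derivative_add[OF has_vector_derivative_add[OF has_vector_derivative_const[of c]
          has_vector_derivative_scaleR[OF this(1) has_vector_derivative_const[of u]]]
        has_vector_derivative_scaleR[OF this(2) has_vector_derivative_const[of v]]]
    show ?thesis by (simp add: circle_point_def T_def)
  qed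
  show "(T has_vector_derivative A t) (at t)" if "t \<in> {0<..<R * \<alpha>} - {}" for t
  proof -
    have "((\<lambda>t. - sin (t / R)) has_real_derivative - (cos (t / R) / R)) (at t)"
      "((\<lambda>t. cos (t / R)) has_real_derivative - (sin (t / R) / R)) (at t)"
      by (rule derivative_eq_intros refl | use Rpos in simp)+
    from has_vector_derivative_add[OF
        has_vector_derivative_scaleR[OF this(1) has_vector_derivative_const[of u]]
        has_vector_derivative_scaleR[OF this(2) has_vector_derivative_const[of v]]]
    show ?thesis by (simp add: T_def[abs_def] A_def)
  qed
  show "continuous_on ({0<..<R * \<alpha>} - {}) A"
    unfolding A_def[abs_def] using Rpos by (intro continuous_intros) auto
  have uu: "u \<bullet> u = 1" "v \<bullet> v = 1" "v \<bullet> u = 0"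
    using u v uv by (simp_all add: norm_eq_1 inner_commute)
  have TT: "T t \<bullet> T w = cos ((t - w) / R)" for t w
    unfolding T_def inner_add_left inner_add_right inner_scaleR_left inner_scaleR_right uu uv
    by (simp add: cos_diff diff_divide_distrib)
  show "norm (T t) = 1" for t
    using TT[of t t] by (simp add: norm_eq_1)
  show "norm (T t - T w) \<le> \<kappa> * \<bar>t - w\<bar>" for t w
  proof -
    define z where "z = (t - w) / R"
    have "(norm (T t - T w))\<^sup>2 = 2 - 2 * cos z"
      unfolding power2_norm_eq_inner inner_diff_left inner_diff_right TT z_def
      using cos_minus[of "(t - w) / R"] by (simp add: diff_divide_distrib)
    also have "\<dots> = (2 * sin (z / 2))\<^sup>2"
      using cos_double_sin[of "z / 2"] by (simp add: power_mult_distrib)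
    finally have "norm (T t - T w) = \<bar>2 * sin (z / 2)\<bar>"
      by (metis norm_ge_zero real_sqrt_abs real_sqrt_unique)
    also have "\<dots> \<le> \<bar>z\<bar>" using abs_sin_x_le_abs_x[of "z / 2"] by simp
    also have "\<dots> = (1 / R) * \<bar>t - w\<bar>" using Rpos by (simp add: z_def)
    also have "\<dots> \<le> \<kappa> * \<bar>t - w\<bar>"
      using R Rpos \<open>0 < \<kappa>\<close> by (intro mult_right_mono) (auto simp: field_simps)
    finally show ?thesis .
  qed
  show "inj_on (\<lambda>t. circle_point c u v R (t / R)) {0..R * \<alpha>}"
  proof (rule inj_onI)
    fix s t assume st: "s \<in> {0..R * \<alpha>}" "t \<in> {0..R * \<alpha>}"
      and eq: "circle_point c u v R (s / R) = circle_point c u v R (t / R)"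
    have cu: "(circle_point c u v R \<theta> - c) \<bullet> u = R * cos \<theta>"
      "(circle_point c u v R \<theta> - c) \<bullet> v = R * sin \<theta>" for \<theta>
      using uu uv by (simp_all add: circle_point_def inner_add_left)
    have "R * cos (s / R) = R * cos (t / R)"
      using cu(1)[of "s / R"] cu(1)[of "t / R"] unfolding eq by (rule trans[OF sym])
    moreover have "R * sin (s / R) = R * sin (t / R)"
      using cu(2)[of "s / R"] cu(2)[of "t / R"] unfolding eq by (rule trans[OF sym])
    ultimately have "sin (s / R) = sin (t / R) \<and> cos (s / R) = cos (t / R)"
      using Rpos by simp
    then obtain n :: int where n: "s / R = t / R + 2 * pi * n"
      unfolding sin_cos_eq_iff by blast
    have "s / R \<in> {0..\<alpha>}" "t / R \<in> {0..\<alpha>}" using st Rpos by (auto simp: field_simps)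
    then have "\<bar>2 * pi * n\<bar> < 2 * pi" using n \<alpha> by auto
    then have "\<bar>real_of_int n\<bar> < 1" by (simp add: abs_mult)
    then have "n = 0" by linarith
    then show "s = t" using n Rpos by simp
  qed
qed (use assms in auto)

text \<open>
  Enlargement by \<open>\<mu> \<ge> 1\<close> divides the curvature by \<open>\<mu>\<close> and an isometry preserves it, so an initial
  piece may be moved to any position and enlarged.
\<close>

lemma similar_subarc:
  fixes R :: "real^3 \<Rightarrow> real^3" and z :: "real^3"
  assumes \<kappa>: "0 < \<kappa>" and arc: "constrained_arc \<kappa> s \<gamma>" and b: "0 < b" "b \<le> s" and \<mu>: "1 \<le> \<mu>"
    and R: "linear R" "\<And>v. norm (R v) = norm v"
  defines "g \<equiv> \<lambda>t\<in>{0..\<mu> * b}. z + \<mu> *\<^sub>R R (\<gamma> (t / \<mu>) - \<gamma> 0)"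
  shows "constrained_arc \<kappa> (\<mu> * b) g"
    and "\<And>t. t \<in> {0..\<mu> * b} \<Longrightarrow> velocity (\<mu> * b) g t = R (velocity s \<gamma> (t / \<mu>))"
proof -
  define V where "V = velocity s \<gamma>"
  define T where "T t = R (V (t / \<mu>))" for t
  interpret unit_speed_curve \<kappa> s \<gamma> V
    unfolding V_def using constrained_arc_imp_unit_speed[OF \<kappa> arc] .
  obtain F A where F: "finite F" and A: "\<And>t. t \<in> {0<..<s} - F \<Longrightarrow> (V has_vector_derivative A t) (at t)"
    and contA: "continuous_on ({0<..<s} - F) A"
    unfolding V_def using constrained_arc_acceleration[OF arc] by blast
  have \<mu>0: "0 < \<mu>" using \<mu> by simp
  have mem: "t / \<mu> \<in> {0..b}" "t / \<mu> \<in> {0..s}" if "t \<in> {0..\<mu> * b}" for t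
  proof -
    show "t / \<mu> \<in> {0..b}" using that \<mu>0 by (auto simp: field_simps)
    then show "t / \<mu> \<in> {0..s}" using b by auto
  qed
  have bl: "bounded_linear R" using R(1) by (simp add: linear_conv_bounded_linear)
  have scale: "((\<lambda>t. t / \<mu>) has_vector_derivative 1 / \<mu>) (at t within S)" for t S
    using has_vector_derivative_mult_left[OF has_vector_derivative_id, of "1 / \<mu>"] by simp
  have der: "((\<lambda>t. z + \<mu> *\<^sub>R R (\<gamma> (t / \<mu>) - \<gamma> 0)) has_vector_derivative T t) (at t within {0..\<mu> * b})"
    if t: "t \<in> {0..\<mu> * b}" for t
  proof -
    have "(\<gamma> has_vector_derivative V (t / \<mu>)) (at (t / \<mu>) within (\<lambda>t. t / \<mu>) ` {0..\<mu> * b})"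
      by (rule has_vector_derivative_within_subset[OF has_tangent[OF mem(2)[OF t]]])
        (use mem(2) in blast)
    from has_vector_derivative_diff[OF vector_diff_chain_within[OF scale this]
        has_vector_derivative_const[of "\<gamma> 0"]]
    have "((\<lambda>t. \<gamma> (t / \<mu>) - \<gamma> 0) has_vector_derivative (1 / \<mu>) *\<^sub>R V (t / \<mu>)) (at t within {0..\<mu> * b})"
      by (simp add: o_def)
    from bounded_linear.has_vector_derivative[OF bl this]
    have "((\<lambda>t. R (\<gamma> (t / \<mu>) - \<gamma> 0)) has_vector_derivative (1 / \<mu>) *\<^sub>R T t) (at t within {0..\<mu> * b})"
      by (simp add: T_def linear_scale[OF R(1)])
    from bounded_linear.has_vector_derivative[OF bounded_linear_scaleR_right[of \<mu>] this]
    have "((\<lambda>t. \<mu> *\<^sub>R R (\<gamma> (t / \<mu>) - \<gamma> 0)) has_vector_derivative T t) (at t within {0..\<mu> * b})"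
      using \<mu>0 by simp
    from has_vector_derivative_add[OF has_vector_derivative_const[of z] this] show ?thesis by simp
  qed
  have unit: "norm (T t) = 1" if "t \<in> {0..\<mu> * b}" for t
    using unit_tangent[OF mem(2)[OF that]] by (simp add: T_def R(2))
  have lip: "norm (T t - T u) \<le> \<kappa> * \<bar>t - u\<bar>" if "t \<in> {0..\<mu> * b}" "u \<in> {0..\<mu> * b}" for t u
  proof -
    have "norm (T t - T u) = norm (V (t / \<mu>) - V (u / \<mu>))"
      by (simp add: T_def R(2) flip: linear_diff[OF R(1)])
    also have "\<dots> \<le> \<kappa> * \<bar>t / \<mu> - u / \<mu>\<bar>" using mem(2) that by (intro tangent_Lipschitz)
    also have "\<dots> = \<kappa> * (\<bar>t - u\<bar> / \<mu>)" using \<mu>0 by (simp flip: diff_divide_distrib)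
    also have "\<dots> \<le> \<kappa> * \<bar>t - u\<bar>"
      using \<kappa> \<mu> by (intro mult_left_mono) (auto simp: divide_le_eq mult_le_cancel_left1)
    finally show ?thesis .
  qed
  have inj: "inj_on (\<lambda>t. z + \<mu> *\<^sub>R R (\<gamma> (t / \<mu>) - \<gamma> 0)) {0..\<mu> * b}"
  proof (rule inj_onI)
    fix t u assume tu: "t \<in> {0..\<mu> * b}" "u \<in> {0..\<mu> * b}"
      and "z + \<mu> *\<^sub>R R (\<gamma> (t / \<mu>) - \<gamma> 0) = z + \<mu> *\<^sub>R R (\<gamma> (u / \<mu>) - \<gamma> 0)"
    then have "R (\<gamma> (t / \<mu>) - \<gamma> 0) = R (\<gamma> (u / \<mu>) - \<gamma> 0)" using \<mu>0 by simp
    then have "R ((\<gamma> (t / \<mu>) - \<gamma> 0) - (\<gamma> (u / \<mu>) - \<gamma> 0)) = 0" by (simp add: linear_diff[OF R(1)])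
    then have "norm ((\<gamma> (t / \<mu>) - \<gamma> 0) - (\<gamma> (u / \<mu>) - \<gamma> 0)) = 0" using R(2) by (metis norm_zero)
    then have "\<gamma> (t / \<mu>) = \<gamma> (u / \<mu>)" by simp
    moreover have "inj_on \<gamma> {0..s}" using arc by (simp add: constrained_arc_def)
    ultimately have "t / \<mu> = u / \<mu>" using mem(2) tu by (blast dest: inj_onD)
    then show "t = u" using \<mu>0 by simp
  qed
  define F' where "F' = (\<lambda>t. \<mu> * t) ` F"
  have mem': "t / \<mu> \<in> {0<..<s} - F" if "t \<in> {0<..<\<mu> * b} - F'" for t
  proof -
    have "t / \<mu> < b" "0 < t / \<mu>" using that \<mu>0 by (auto simp: field_simps)
    moreover have "t / \<mu> \<notin> F"
    proof
      assume "t / \<mu> \<in> F"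
      then have "\<mu> * (t / \<mu>) \<in> F'" unfolding F'_def by blast
      then show False using that \<mu>0 by simp
    qed
    ultimately show ?thesis using b by auto
  qed
  have acc: "(T has_vector_derivative (1 / \<mu>) *\<^sub>R R (A (t / \<mu>))) (at t)"
    if t: "t \<in> {0<..<\<mu> * b} - F'" for t
  proof -
    have "((\<lambda>t. V (t / \<mu>)) has_vector_derivative (1 / \<mu>) *\<^sub>R A (t / \<mu>)) (at t)"
      using vector_diff_chain_at[OF scale A[OF mem'[OF t]]] by (simp add: o_def)
    from bounded_linear.has_vector_derivative[OF bl this]
    show ?thesis by (simp add: T_def[abs_def] linear_scale[OF R(1)])
  qed
  have cont: "continuous_on ({0<..<\<mu> * b} - F') (\<lambda>t. (1 / \<mu>) *\<^sub>R R (A (t / \<mu>)))"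
    by (intro continuous_intros bounded_linear.continuous_on[OF bl] continuous_on_compose2[OF contA])
      (use mem' \<mu>0 in auto)
  have "0 < \<mu> * b" using \<mu>0 b by simp
  from constrained_arc_restrictI[OF \<kappa> this der unit lip inj _ acc cont] F
  show "constrained_arc \<kappa> (\<mu> * b) g"
    and "\<And>t. t \<in> {0..\<mu> * b} \<Longrightarrow> velocity (\<mu> * b) g t = R (velocity s \<gamma> (t / \<mu>))"
    unfolding g_def F'_def T_def V_def by auto
qed

section \<open>The spindle of two points\<close>

text \<open>
  Cylindrical coordinates about the line through \<open>x\<close> and \<open>y\<close>, with origin at the midpoint:
  \<open>along\<close> is the coordinate on the line and \<open>across\<close> the distance from it. The points at distance \<open>r\<close>
  from both \<open>x\<close> and \<open>y\<close> have coordinates \<open>0\<close> and \<open>centre_height r x y\<close>.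
\<close>

definition chord_axis :: "real^3 \<Rightarrow> real^3 \<Rightarrow> real^3" where
  "chord_axis x y = (y - x) /\<^sub>R dist x y"

definition along :: "real^3 \<Rightarrow> real^3 \<Rightarrow> real^3 \<Rightarrow> real" where
  "along x y p = (p - midpoint x y) \<bullet> chord_axis x y"

definition across :: "real^3 \<Rightarrow> real^3 \<Rightarrow> real^3 \<Rightarrow> real" where
  "across x y p = norm (p - midpoint x y - along x y p *\<^sub>R chord_axis x y)"

definition centre_height :: "real \<Rightarrow> real^3 \<Rightarrow> real^3 \<Rightarrow> real" where
  "centre_height r x y = sqrt (r\<^sup>2 - (dist x y / 2)\<^sup>2)"

text \<open>
  The solid obtained by revolving a symmetric lens with tips \<open>x\<close> and \<open>y\<close> about its chord. In the form
  of an intersection of balls it is visibly convex, and an arc is in it as soon as it is in each ball.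
\<close>

definition spindle :: "real \<Rightarrow> real^3 \<Rightarrow> real^3 \<Rightarrow> (real^3) set" where
  "spindle r x y = (\<Inter>c\<in>{c. dist c x = r \<and> dist c y = r}. cball c r)"

lemma norm_axis: "x \<noteq> y \<Longrightarrow> norm (chord_axis x y) = 1"
  by (simp add: chord_axis_def dist_norm norm_minus_commute)

lemma endpoints_on_axis:
  assumes "x \<noteq> y"
  shows "x = midpoint x y + (- (dist x y / 2)) *\<^sub>R chord_axis x y"
    and "y = midpoint x y + (dist x y / 2) *\<^sub>R chord_axis x y"
proof -
  have "dist x y *\<^sub>R chord_axis x y = y - x" using assms by (simp add: chord_axis_def)
  then have *: "(dist x y / 2) *\<^sub>R chord_axis x y = (1 / 2) *\<^sub>R (y - x)"
    by (metis scaleR_scaleR times_divide_eq_left mult_1)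
  show "x = midpoint x y + (- (dist x y / 2)) *\<^sub>R chord_axis x y"
    and "y = midpoint x y + (dist x y / 2) *\<^sub>R chord_axis x y"
    unfolding scaleR_minus_left * midpoint_def
    by (simp_all add: vec_eq_iff field_simps)
qed

lemma norm_orthonormal_combination:
  fixes e q :: "'a::real_inner"
  assumes "norm e = 1" "norm q = 1" "q \<bullet> e = 0"
  shows "(norm (a *\<^sub>R e + b *\<^sub>R q))\<^sup>2 = a\<^sup>2 + b\<^sup>2"
  using assms unfolding power2_norm_eq_inner
  by (simp add: inner_add_left inner_add_right inner_commute norm_eq_1 power2_eq_square)

lemma diff_eq_of_sum: "p = m + u + v \<Longrightarrow> p - m = u + v" for p :: "'a::ab_group_add"
  by simp

lemma cylindrical_coordinates:
  assumes "x \<noteq> y"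
  obtains q where "norm q = 1" "q \<bullet> chord_axis x y = 0"
    "p = midpoint x y + along x y p *\<^sub>R chord_axis x y + across x y p *\<^sub>R q"
proof -
  define w where "w = p - midpoint x y - along x y p *\<^sub>R chord_axis x y"
  have p: "p = midpoint x y + along x y p *\<^sub>R chord_axis x y + w" by (simp add: w_def)
  have wn: "across x y p = norm w" by (simp add: across_def w_def)
  have we: "w \<bullet> chord_axis x y = 0"
    using norm_axis[OF assms] by (simp add: w_def along_def inner_diff_left norm_eq_1)
  show ?thesis
  proof (cases "w = 0")
    case True
    obtain z where z: "z \<noteq> 0" "orthogonal (chord_axis x y) z"
      using orthogonal_to_vector_exists[of "chord_axis x y"] by auto
    show ?thesis
      using z p True wn
      by (intro that[of "z /\<^sub>R norm z"]) (auto simp: orthogonal_def inner_commute)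
  next
    case False
    then show ?thesis
      using p wn we by (intro that[of "w /\<^sub>R norm w"]) auto
  qed
qed

lemma along_across_eqI:
  assumes "x \<noteq> y" "norm q = 1" "q \<bullet> chord_axis x y = 0" "0 \<le> b"
    and p: "p = midpoint x y + a *\<^sub>R chord_axis x y + b *\<^sub>R q"
  shows "along x y p = a" "across x y p = b"
proof -
  show "along x y p = a"
    unfolding along_def p using assms norm_axis[OF assms(1)]
    by (simp add: inner_add_left norm_eq_1)
  then show "across x y p = b"
    unfolding across_def using assms by (simp add: p)
qed

text \<open>
  The frame \<open>q\<close>, \<open>e\<close> is the radius through the middle of an arc of angle \<open>2 \<beta>\<close> and the tangent there; the
  frame of \<^const>\<open>circle_point\<close> is the radius through the start of the arc and the tangent there.
\<close>

lemma circle_point_symmetric_frame: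
  "circle_point c (cos \<beta> *\<^sub>R q - sin \<beta> *\<^sub>R e) (sin \<beta> *\<^sub>R q + cos \<beta> *\<^sub>R e) R \<theta>
     = c + (R * cos (\<theta> - \<beta>)) *\<^sub>R q + (R * sin (\<theta> - \<beta>)) *\<^sub>R e"
  by (simp add: circle_point_def cos_diff sin_diff algebra_simps)

context
  fixes r :: real and x y :: "real^3"
  assumes dist_pos: "0 < dist x y" and dist_less: "dist x y < 2 * r"
begin

lemma x_neq_y: "x \<noteq> y"
  using dist_pos by auto

lemma radius_pos: "0 < r"
  using dist_pos dist_less by linarith

lemma centre_height_pos: "0 < centre_height r x y"
proof -
  have "(dist x y / 2)\<^sup>2 < r\<^sup>2" using dist_pos dist_less by (intro power_strict_mono) auto
  then show ?thesis by (simp add: centre_height_def)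
qed

lemma centre_height_sq: "(centre_height r x y)\<^sup>2 + (dist x y / 2)\<^sup>2 = r\<^sup>2"
proof -
  have "(dist x y / 2)\<^sup>2 \<le> r\<^sup>2" using dist_pos dist_less by (intro power_mono) auto
  then show ?thesis by (simp add: centre_height_def)
qed

lemma centre_of_normal:
  assumes "norm q = 1" "q \<bullet> chord_axis x y = 0"
  defines "c \<equiv> midpoint x y - centre_height r x y *\<^sub>R q"
  shows "dist c x = r" "dist c y = r"
proof -
  have *: "dist c (midpoint x y + b *\<^sub>R chord_axis x y) = r" if "b\<^sup>2 = (dist x y / 2)\<^sup>2" for b
  proof -
    have "(dist c (midpoint x y + b *\<^sub>R chord_axis x y))\<^sup>2
        = (norm ((- b) *\<^sub>R chord_axis x y + (- centre_height r x y) *\<^sub>R q))\<^sup>2"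
      by (simp add: c_def dist_norm algebra_simps)
    also have "\<dots> = r\<^sup>2"
      unfolding norm_orthonormal_combination[OF norm_axis[OF x_neq_y] assms(1,2)]
      using centre_height_sq that by simp
    finally show ?thesis using radius_pos by (simp add: power2_eq_iff_nonneg)
  qed
  show "dist c x = r" "dist c y = r"
    using *[of "- (dist x y / 2)"] *[of "dist x y / 2"] endpoints_on_axis[OF x_neq_y] by simp_all
qed

lemma dist_centre_of_normal:
  assumes "norm q = 1" "q \<bullet> chord_axis x y = 0"
    and p: "p = midpoint x y + a *\<^sub>R chord_axis x y + b *\<^sub>R q"
  shows "(dist (midpoint x y - centre_height r x y *\<^sub>R q) p)\<^sup>2 = a\<^sup>2 + (b + centre_height r x y)\<^sup>2"
proof -
  have "(dist (midpoint x y - centre_height r x y *\<^sub>R q) p)\<^sup>2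
      = (norm ((- a) *\<^sub>R chord_axis x y + (- (b + centre_height r x y)) *\<^sub>R q))\<^sup>2"
    by (simp add: p dist_norm algebra_simps)
  also have "\<dots> = a\<^sup>2 + (b + centre_height r x y)\<^sup>2"
    unfolding norm_orthonormal_combination[OF norm_axis[OF x_neq_y] assms(1,2)]
    by (simp only: power2_minus)
  finally show ?thesis .
qed

text \<open>
  Of all the balls, the one which comes closest to excluding \<open>p\<close> has its centre exactly opposite to \<open>p\<close>,
  at distance \<open>across x y p + centre_height r x y\<close> from \<open>p\<close> in the direction orthogonal to the chord.
\<close>

lemma mem_spindle_iff:
  "p \<in> spindle r x y \<longleftrightarrow> (along x y p)\<^sup>2 + (across x y p + centre_height r x y)\<^sup>2 \<le> r\<^sup>2"
proof
  obtain q where q: "norm q = 1" "q \<bullet> chord_axis x y = 0"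
    and p: "p = midpoint x y + along x y p *\<^sub>R chord_axis x y + across x y p *\<^sub>R q"
    using cylindrical_coordinates[OF x_neq_y] by blast
  assume "p \<in> spindle r x y"
  then have "dist (midpoint x y - centre_height r x y *\<^sub>R q) p \<le> r"
    using centre_of_normal[OF q] by (auto simp: spindle_def)
  then have "(dist (midpoint x y - centre_height r x y *\<^sub>R q) p)\<^sup>2 \<le> r\<^sup>2"
    by (intro power_mono) auto
  then show "(along x y p)\<^sup>2 + (across x y p + centre_height r x y)\<^sup>2 \<le> r\<^sup>2"
    unfolding dist_centre_of_normal[OF q p] .
next
  assume le: "(along x y p)\<^sup>2 + (across x y p + centre_height r x y)\<^sup>2 \<le> r\<^sup>2"
  define a where "a = along x y p"
  define e where "e = chord_axis x y"
  define w where "w = p - midpoint x y - a *\<^sub>R e"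
  have e: "e \<bullet> e = 1" using norm_axis[OF x_neq_y] by (simp add: e_def norm_eq_1)
  have we: "w \<bullet> e = 0" using e by (simp add: w_def a_def along_def e_def inner_diff_left)
  have wn: "across x y p = norm w" by (simp add: w_def a_def e_def across_def)
  show "p \<in> spindle r x y"
    unfolding spindle_def
  proof (rule INT_I)
    fix c assume "c \<in> {c. dist c x = r \<and> dist c y = r}"
    then have cx: "dist c x = r" and cy: "dist c y = r" by auto
    define n where "n = c - midpoint x y"
    define D where "D = dist x y / 2"
    have D: "D > 0" using dist_pos by (simp add: D_def)
    have "x = midpoint x y + (- D) *\<^sub>R e" "y = midpoint x y + D *\<^sub>R e"
      using endpoints_on_axis[OF x_neq_y] by (simp_all add: D_def e_def)
    then have "c - x = n + D *\<^sub>R e" "c - y = n - D *\<^sub>R e"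
      by (simp_all add: n_def algebra_simps)
    then have "(n + D *\<^sub>R e) \<bullet> (n + D *\<^sub>R e) = r\<^sup>2" "(n - D *\<^sub>R e) \<bullet> (n - D *\<^sub>R e) = r\<^sup>2"
      using cx cy by (simp_all add: dist_norm flip: power2_norm_eq_inner)
    then have 1: "n \<bullet> n + 2 * D * (n \<bullet> e) + D\<^sup>2 = r\<^sup>2" "n \<bullet> n - 2 * D * (n \<bullet> e) + D\<^sup>2 = r\<^sup>2"
      using e by (simp_all add: inner_add_left inner_add_right inner_diff_left inner_diff_right
          inner_commute power2_eq_square algebra_simps)
    then have "D * (n \<bullet> e) = 0" by linarith
    then have ne: "n \<bullet> e = 0" using D by simp
    then have "n \<bullet> n = (centre_height r x y)\<^sup>2" using 1 centre_height_sq by (simp add: D_def)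
    then have nn: "norm n = centre_height r x y"
      using centre_height_pos by (simp add: norm_eq_sqrt_inner)
    have "p - c = a *\<^sub>R e + (w - n)" by (simp add: w_def n_def)
    then have "(dist c p)\<^sup>2 = (a *\<^sub>R e + (w - n)) \<bullet> (a *\<^sub>R e + (w - n))"
      by (simp only: dist_norm norm_minus_commute[of c] power2_norm_eq_inner)
    also have "\<dots> = a\<^sup>2 + (norm (w - n))\<^sup>2"
      using e we ne unfolding power2_norm_eq_inner
      by (simp add: inner_add_left inner_add_right inner_diff_left inner_diff_right
          inner_commute power2_eq_square)
    also have "\<dots> \<le> a\<^sup>2 + (norm w + norm n)\<^sup>2"
      using norm_triangle_ineq4[of w n] by (intro add_left_mono power_mono) auto
    also have "\<dots> \<le> r\<^sup>2" using le by (simp add: a_def wn nn)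
    finally have "dist c p \<le> r" using radius_pos by (auto intro: power2_le_imp_le)
    then show "p \<in> cball c r" by simp
  qed
qed

lemma centre_exists: "\<exists>c. dist c x = r \<and> dist c y = r"
proof -
  obtain q where "norm q = 1" "q \<bullet> chord_axis x y = 0"
    using cylindrical_coordinates[OF x_neq_y] by blast
  then show ?thesis using centre_of_normal by blast
qed

lemma compact_spindle: "compact (spindle r x y)"
proof -
  obtain c where "dist c x = r" "dist c y = r" using centre_exists by blast
  then have "spindle r x y \<subseteq> cball c r" by (auto simp: spindle_def)
  then have "bounded (spindle r x y)" using bounded_cball bounded_subset by blast
  moreover have "closed (spindle r x y)" unfolding spindle_def by (intro closed_INT) auto
  ultimately show ?thesis by (simp add: compact_eq_bounded_closed)
qed

lemma convex_spindle: "convex (spindle r x y)"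
  unfolding spindle_def by (intro convex_INT) auto

lemma continuous_on_coordinates:
  "continuous_on S (along x y)" "continuous_on S (across x y)"
  unfolding along_def[abs_def] across_def[abs_def] by (intro continuous_intros)+

text \<open>
  In the case of equality \<open>p\<close> is on the boundary sphere of the ball whose centre is opposite to \<open>p\<close>.
\<close>

lemma mem_interior_spindle_iff:
  "p \<in> interior (spindle r x y) \<longleftrightarrow>
     (along x y p)\<^sup>2 + (across x y p + centre_height r x y)\<^sup>2 < r\<^sup>2"
proof
  obtain q where q: "norm q = 1" "q \<bullet> chord_axis x y = 0"
    and p: "p = midpoint x y + along x y p *\<^sub>R chord_axis x y + across x y p *\<^sub>R q"
    using cylindrical_coordinates[OF x_neq_y] by blast
  let ?c = "midpoint x y - centre_height r x y *\<^sub>R q"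
  have "spindle r x y \<subseteq> cball ?c r"
    using centre_of_normal[OF q] by (auto simp: spindle_def)
  then have "interior (spindle r x y) \<subseteq> ball ?c r"
    using interior_mono interior_cball by blast
  moreover assume "p \<in> interior (spindle r x y)"
  ultimately have "dist ?c p < r" by auto
  then have "(dist ?c p)\<^sup>2 < r\<^sup>2" by (intro power_strict_mono) auto
  then show "(along x y p)\<^sup>2 + (across x y p + centre_height r x y)\<^sup>2 < r\<^sup>2"
    unfolding dist_centre_of_normal[OF q p] .
next
  let ?U = "{p. (along x y p)\<^sup>2 + (across x y p + centre_height r x y)\<^sup>2 < r\<^sup>2}"
  have "open ?U"
    by (intro open_Collect_less continuous_intros continuous_on_coordinates)
  moreover have "?U \<subseteq> spindle r x y" by (auto simp: mem_spindle_iff)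
  ultimately have "?U \<subseteq> interior (spindle r x y)" by (rule interior_maximal[rotated])
  then show "(along x y p)\<^sup>2 + (across x y p + centre_height r x y)\<^sup>2 < r\<^sup>2
      \<Longrightarrow> p \<in> interior (spindle r x y)" by blast
qed

lemma mem_frontier_spindle_iff:
  "p \<in> frontier (spindle r x y) \<longleftrightarrow>
     (along x y p)\<^sup>2 + (across x y p + centre_height r x y)\<^sup>2 = r\<^sup>2"
proof -
  have "frontier (spindle r x y) = spindle r x y - interior (spindle r x y)"
    using compact_imp_closed[OF compact_spindle] by (simp add: frontier_def closure_closed)
  then show ?thesis by (auto simp: mem_interior_spindle_iff mem_spindle_iff)
qed

text \<open>
  Since \<open>r\<^sup>2 = h\<^sup>2 + (dist x y / 2)\<^sup>2\<close>, the condition for the spindle is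
  \<open>a\<^sup>2 + b\<^sup>2 + 2 b h \<le> (dist x y / 2)\<^sup>2\<close> with \<open>a\<close>, \<open>b \<ge> 0\<close> the coordinates of the point and \<open>h > 0\<close> the
  height of the centres. So the spindle has diameter \<open>dist x y\<close>.
\<close>

lemma spindle_subset_cball: "spindle r x y \<subseteq> cball (midpoint x y) (dist x y / 2)"
proof
  fix p assume "p \<in> spindle r x y"
  then have le: "(along x y p)\<^sup>2 + (across x y p + centre_height r x y)\<^sup>2 \<le> r\<^sup>2"
    by (simp add: mem_spindle_iff)
  obtain q where q: "norm q = 1" "q \<bullet> chord_axis x y = 0"
    and p: "p = midpoint x y + along x y p *\<^sub>R chord_axis x y + across x y p *\<^sub>R q"
    using cylindrical_coordinates[OF x_neq_y] by blast
  have "p - midpoint x y = along x y p *\<^sub>R chord_axis x y + across x y p *\<^sub>R q"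
    by (rule diff_eq_of_sum[OF p])
  then have "dist (midpoint x y) p = norm (along x y p *\<^sub>R chord_axis x y + across x y p *\<^sub>R q)"
    by (simp only: dist_norm norm_minus_commute[of "midpoint x y"])
  then have "(dist (midpoint x y) p)\<^sup>2 = (along x y p)\<^sup>2 + (across x y p)\<^sup>2"
    by (simp only: norm_orthonormal_combination[OF norm_axis[OF x_neq_y] q])
  also have "\<dots> \<le> (along x y p)\<^sup>2 + (across x y p + centre_height r x y)\<^sup>2 - (centre_height r x y)\<^sup>2"
  proof -
    have "0 \<le> 2 * across x y p * centre_height r x y"
      using centre_height_pos by (simp add: across_def)
    then show ?thesis by (simp add: power2_sum)
  qed
  also have "\<dots> \<le> (dist x y / 2)\<^sup>2" using le centre_height_sq by linarith
  finally show "p \<in> cball (midpoint x y) (dist x y / 2)"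
    by (auto intro: power2_le_imp_le)
qed

lemma midpoint_in_interior_spindle: "midpoint x y \<in> interior (spindle r x y)"
proof -
  have "along x y (midpoint x y) = 0" "across x y (midpoint x y) = 0"
    by (simp_all add: along_def across_def)
  moreover have "(centre_height r x y)\<^sup>2 < r\<^sup>2" 
  proof -
    have "0 < (dist x y / 2)\<^sup>2" using dist_pos by simp
    then show ?thesis using centre_height_sq by linarith
  qed
  ultimately show ?thesis by (simp add: mem_interior_spindle_iff)
qed

text \<open>
  In the symmetric frame of an arc of angle \<open>2 \<beta>\<close> the height of a point above the chord is
  \<open>r cos (\<theta> - \<beta>) - r cos \<beta>\<close>. It is nonnegative because \<open>\<beta> < \<pi> / 2\<close>, which is where shortness enters: the
  centre lies on the other side of the chord.
\<close>

lemma short_arc_subset_frontier_spindle: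
  assumes "norm u = 1" "norm v = 1" "u \<bullet> v = 0"
    and x: "circle_point c u v r 0 = x" and y: "circle_point c u v r \<alpha> = y"
    and \<alpha>: "0 < \<alpha>" "\<alpha> < 2 * pi - \<alpha>"
  shows "circular_arc c u v r \<alpha> \<subseteq> frontier (spindle r x y)"
  unfolding circular_arc_def
proof (rule image_subsetI)
  fix \<theta> assume \<theta>: "\<theta> \<in> {0..\<alpha>}"
  note r = radius_pos
  define \<beta> where "\<beta> = \<alpha> / 2"
  define q where "q = cos \<beta> *\<^sub>R u + sin \<beta> *\<^sub>R v"
  define e where "e = cos \<beta> *\<^sub>R v - sin \<beta> *\<^sub>R u"
  have \<beta>: "0 < \<beta>" "\<beta> < pi / 2" using \<alpha> by (simp_all add: \<beta>_def)
  have cs: "cos \<beta> * cos \<beta> + sin \<beta> * sin \<beta> = 1"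
    using sin_cos_squared_add3[of \<beta>] by simp
  have uu: "u \<bullet> u = 1" "v \<bullet> v = 1" "v \<bullet> u = 0"
    using assms(1-3) by (simp_all add: norm_eq_1 inner_commute)
  have q1: "norm q = 1" and e1: "norm e = 1" and qe: "q \<bullet> e = 0"
    unfolding norm_eq_1 q_def e_def inner_add_left inner_add_right inner_diff_left inner_diff_right
      inner_scaleR_left inner_scaleR_right uu assms(3) using cs by simp_all
  have u: "u = cos \<beta> *\<^sub>R q - sin \<beta> *\<^sub>R e" and v: "v = sin \<beta> *\<^sub>R q + cos \<beta> *\<^sub>R e"
  proof -
    have "cos \<beta> *\<^sub>R q - sin \<beta> *\<^sub>R e = (cos \<beta> * cos \<beta>) *\<^sub>R u + (sin \<beta> * sin \<beta>) *\<^sub>R u"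
      "sin \<beta> *\<^sub>R q + cos \<beta> *\<^sub>R e = (cos \<beta> * cos \<beta>) *\<^sub>R v + (sin \<beta> * sin \<beta>) *\<^sub>R v"
      by (simp_all add: q_def e_def algebra_simps)
    then show "u = cos \<beta> *\<^sub>R q - sin \<beta> *\<^sub>R e" "v = sin \<beta> *\<^sub>R q + cos \<beta> *\<^sub>R e"
      unfolding scaleR_add_left[symmetric] cs by simp_all
  qed
  have point: "circle_point c u v r \<theta> = c + (r * cos (\<theta> - \<beta>)) *\<^sub>R q + (r * sin (\<theta> - \<beta>)) *\<^sub>R e" for \<theta>
    unfolding u v by (rule circle_point_symmetric_frame)
  have x': "x = c + (r * cos \<beta>) *\<^sub>R q - (r * sin \<beta>) *\<^sub>R e" using x point[of 0] by simp
  have y': "y = c + (r * cos \<beta>) *\<^sub>R q + (r * sin \<beta>) *\<^sub>R e" using y point[of \<alpha>] by (simp add: \<beta>_def)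
  have mid: "midpoint x y = c + (r * cos \<beta>) *\<^sub>R q"
    unfolding x' y' midpoint_def by (simp add: vec_eq_iff)
  have yx: "y - x = (2 * (r * sin \<beta>)) *\<^sub>R e"
    unfolding x' y' by (simp add: vec_eq_iff)
  have "0 < sin \<beta>" using \<beta> by (intro sin_gt_zero) auto
  then have rs: "0 < r * sin \<beta>" using r by simp
  have "dist x y = norm (y - x)" by (simp add: dist_norm norm_minus_commute)
  also have "\<dots> = 2 * (r * sin \<beta>)" unfolding yx using rs e1 by simp
  finally have d: "dist x y = 2 * (r * sin \<beta>)" .
  have "2 * (r * sin \<beta>) \<noteq> 0" using rs by linarith
  then have "inverse (2 * (r * sin \<beta>)) * (2 * (r * sin \<beta>)) = 1" by (rule left_inverse)
  then have ax: "chord_axis x y = e"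
    by (simp only: chord_axis_def yx d scaleR_scaleR scaleR_one)
  have "0 < cos \<beta>" using \<beta> by (intro cos_gt_zero) auto
  have "(centre_height r x y)\<^sup>2 = (r * cos \<beta>)\<^sup>2"
    using centre_height_sq sin_cos_squared_add[of \<beta>]
    by (simp add: d power_mult_distrib) (simp add: cos_squared_eq algebra_simps)
  then have h: "centre_height r x y = r * cos \<beta>"
    using centre_height_pos r \<open>0 < cos \<beta>\<close>
    by (simp add: power2_eq_iff_nonneg)
  have "cos \<beta> \<le> cos \<bar>\<theta> - \<beta>\<bar>"
    using \<theta> \<beta> by (intro cos_monotone_0_pi_le) (auto simp: \<beta>_def abs_if)
  then have nonneg: "0 \<le> r * cos (\<theta> - \<beta>) - r * cos \<beta>"
    using r by (simp add: mult_left_mono)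
  have p: "circle_point c u v r \<theta> = midpoint x y + (r * sin (\<theta> - \<beta>)) *\<^sub>R chord_axis x y
      + (r * cos (\<theta> - \<beta>) - r * cos \<beta>) *\<^sub>R q"
    unfolding point mid ax by (simp add: algebra_simps)
  have "along x y (circle_point c u v r \<theta>) = r * sin (\<theta> - \<beta>)"
    "across x y (circle_point c u v r \<theta>) = r * cos (\<theta> - \<beta>) - r * cos \<beta>"
    using along_across_eqI[OF x_neq_y q1 _ nonneg p] qe by (simp_all add: ax)
  then have "(along x y (circle_point c u v r \<theta>))\<^sup>2
      + (across x y (circle_point c u v r \<theta>) + centre_height r x y)\<^sup>2 = r\<^sup>2"
    using sin_cos_squared_add[of "\<theta> - \<beta>"] unfolding h
    by (simp add: power_mult_distrib flip: distrib_left)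
  then show "circle_point c u v r \<theta> \<in> frontier (spindle r x y)"
    unfolding mem_frontier_spindle_iff .
qed

text \<open>
  The arc is in the plane through \<open>x\<close>, \<open>y\<close> and \<open>p\<close>, on the circle about the centre opposite to \<open>p\<close>.
  Its half angle is \<open>\<beta>\<close>, and \<open>p\<close> is at angle \<open>\<phi>\<close> from its middle.
\<close>

lemma frontier_spindle_subset_short_arcs:
  assumes "p \<in> frontier (spindle r x y)"
  shows "p \<in> \<Union> (short_arcs r x y)"
proof -
  note r = radius_pos
  define h where "h = centre_height r x y"
  define D where "D = dist x y / 2"
  define a where "a = along x y p"
  define b where "b = across x y p"
  define e where "e = chord_axis x y"
  have h: "0 < h" and D: "0 < D" and hD: "h\<^sup>2 + D\<^sup>2 = r\<^sup>2" and b: "0 \<le> b"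
    using centre_height_pos centre_height_sq dist_pos
    by (simp_all add: h_def D_def b_def across_def)
  have on: "a\<^sup>2 + (b + h)\<^sup>2 = r\<^sup>2"
    using assms unfolding mem_frontier_spindle_iff a_def b_def h_def .
  obtain q where q1: "norm q = 1" and qe: "q \<bullet> e = 0" and p: "p = midpoint x y + a *\<^sub>R e + b *\<^sub>R q"
    using cylindrical_coordinates[OF x_neq_y] unfolding a_def b_def e_def by blast
  have e1: "norm e = 1" using norm_axis[OF x_neq_y] by (simp add: e_def)
  have "(h / r)\<^sup>2 + (D / r)\<^sup>2 = 1"
    using hD r by (simp add: power_divide flip: add_divide_distrib)
  then obtain \<beta> where \<beta>: "0 \<le> \<beta>" "\<beta> \<le> pi / 2" "h / r = cos \<beta>" "D / r = sin \<beta>"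
    using sincos_total_pi_half[of "h / r" "D / r"] h D r by auto
  have h': "r * cos \<beta> = h" and D': "r * sin \<beta> = D"
    using \<beta>(3,4)[symmetric] r by simp_all
  have "sin \<beta> \<noteq> 0" "cos \<beta> \<noteq> 0" using h' D' h D by auto
  then have "\<beta> \<noteq> 0" "\<beta> \<noteq> pi / 2" by (metis sin_zero, metis cos_pi_half)
  then have \<beta>': "0 < \<beta>" "\<beta> < pi / 2" using \<beta> by auto
  have "(- a / r)\<^sup>2 + ((b + h) / r)\<^sup>2 = 1"
    using on r by (simp add: power_divide flip: add_divide_distrib)
  then obtain \<psi> where \<psi>: "0 \<le> \<psi>" "\<psi> \<le> pi" "- a / r = cos \<psi>" "(b + h) / r = sin \<psi>"
    using sincos_total_pi[of "(b + h) / r" "- a / r"] b h r by auto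
  define \<phi> where "\<phi> = \<psi> - pi / 2"
  have "sin \<phi> = a / r" "cos \<phi> = (b + h) / r"
    using \<psi> by (simp_all add: \<phi>_def sin_diff cos_diff)
  then have \<phi>: "r * sin \<phi> = a" "r * cos \<phi> = b + h" using r by simp_all
  have "cos \<beta> \<le> cos \<bar>\<phi>\<bar>"
    using b r \<open>cos \<phi> = (b + h) / r\<close> \<beta>(3) by (simp add: divide_right_mono flip: \<beta>(3))
  then have "\<bar>\<phi>\<bar> \<le> \<beta>"
    using \<beta> \<psi> by (subst (asm) cos_mono_le_eq) (auto simp: \<phi>_def abs_le_iff)
  define u where "u = cos \<beta> *\<^sub>R q - sin \<beta> *\<^sub>R e"
  define v where "v = sin \<beta> *\<^sub>R q + cos \<beta> *\<^sub>R e"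
  define c where "c = midpoint x y - h *\<^sub>R q"
  have cs: "cos \<beta> * cos \<beta> + sin \<beta> * sin \<beta> = 1" "sin \<beta> * sin \<beta> + cos \<beta> * cos \<beta> = 1"
    by (metis sin_cos_squared_add3, metis sin_cos_squared_add3 add.commute)
  have qq: "q \<bullet> q = 1" "e \<bullet> e = 1" "e \<bullet> q = 0"
    using q1 e1 qe by (simp_all add: norm_eq_1 inner_commute)
  have uv: "norm u = 1" "norm v = 1" "u \<bullet> v = 0"
    unfolding norm_eq_1 u_def v_def inner_add_left inner_add_right inner_diff_left inner_diff_right
      inner_scaleR_left inner_scaleR_right qq qe using cs by simp_all
  have point: "circle_point c u v r \<theta> = c + (r * cos (\<theta> - \<beta>)) *\<^sub>R q + (r * sin (\<theta> - \<beta>)) *\<^sub>R e" for \<theta>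
    unfolding u_def v_def by (rule circle_point_symmetric_frame)
  have x: "circle_point c u v r 0 = x" and y: "circle_point c u v r (2 * \<beta>) = y"
    using endpoints_on_axis[OF x_neq_y] unfolding point
    by (simp_all add: h' D' c_def D_def e_def)
  have "circle_point c u v r (\<phi> + \<beta>) = p"
    unfolding point by (simp add: \<phi> c_def p algebra_simps)
  moreover have "\<phi> + \<beta> \<in> {0..2 * \<beta>}" using \<open>\<bar>\<phi>\<bar> \<le> \<beta>\<close> by auto
  ultimately have "p \<in> circular_arc c u v r (2 * \<beta>)" unfolding circular_arc_def by blast
  moreover have "circular_arc c u v r (2 * \<beta>) \<in> short_arcs r x y"
    unfolding short_arcs_def using uv x y \<beta>' by fastforce
  ultimately show ?thesis by blast
qed

lemma Union_short_arcs: "\<Union> (short_arcs r x y) = frontier (spindle r x y)"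
proof
  show "\<Union> (short_arcs r x y) \<subseteq> frontier (spindle r x y)"
  proof (rule Union_least)
    fix X assume "X \<in> short_arcs r x y"
    then obtain c u v \<alpha> where X: "X = circular_arc c u v r \<alpha>"
      and arc: "norm u = 1" "norm v = 1" "u \<bullet> v = 0" "circle_point c u v r 0 = x"
        "circle_point c u v r \<alpha> = y" "0 < \<alpha>" "\<alpha> < 2 * pi - \<alpha>"
      unfolding short_arcs_def mem_Collect_eq by blast
    show "X \<subseteq> frontier (spindle r x y)"
      unfolding X by (rule short_arc_subset_frontier_spindle[OF arc])
  qed
qed (use frontier_spindle_subset_short_arcs in blast)

text \<open>The frontier of a bounded convex set encloses exactly the interior.\<close>

lemma closure_inside_short_arcs: "closure (inside (\<Union> (short_arcs r x y))) = spindle r x y"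
proof -
  have "inside (\<Union> (short_arcs r x y)) = interior (spindle r x y)"
    unfolding Union_short_arcs
    by (intro inside_frontier_eq_interior compact_imp_bounded compact_spindle convex_spindle)
  moreover have "closure (interior (spindle r x y)) = closure (spindle r x y)"
    using midpoint_in_interior_spindle
    by (intro convex_closure_interior convex_spindle) auto
  ultimately show ?thesis
    using compact_imp_closed[OF compact_spindle] by (simp add: closure_closed)
qed

end

text \<open>
  A larger radius moves the centres away from the chord and makes the bounding arcs flatter.
\<close>

lemma spindle_antimono:
  assumes "0 < dist x y" "dist x y < 2 * r" "r \<le> R"
  shows "spindle R x y \<subseteq> spindle r x y"
proof
  fix p assume "p \<in> spindle R x y"
  have dR: "dist x y < 2 * R" using assms by linarith
  define a where "a = along x y p"
  define b where "b = across x y p"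
  have b: "0 \<le> b" by (simp add: b_def across_def)
  have "a\<^sup>2 + (b + centre_height R x y)\<^sup>2 \<le> R\<^sup>2"
    using \<open>p \<in> spindle R x y\<close> mem_spindle_iff[OF assms(1) dR] by (simp add: a_def b_def)
  then have "a\<^sup>2 + b\<^sup>2 + 2 * (b * centre_height R x y) \<le> (dist x y / 2)\<^sup>2"
    using centre_height_sq[OF assms(1) dR] by (simp add: power2_sum)
  moreover have "b * centre_height r x y \<le> b * centre_height R x y"
  proof (rule mult_left_mono[OF _ b])
    have "0 \<le> r" using assms(1,2) by linarith
    then have "r\<^sup>2 \<le> R\<^sup>2" using assms(3) by (intro power_mono)
    then show "centre_height r x y \<le> centre_height R x y" by (simp add: centre_height_def)
  qed
  ultimately have "a\<^sup>2 + (b + centre_height r x y)\<^sup>2 \<le> r\<^sup>2"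
    using centre_height_sq[OF assms(1,2)] by (simp add: power2_sum)
  then show "p \<in> spindle r x y"
    using mem_spindle_iff[OF assms(1,2)] by (simp add: a_def b_def)
qed

text \<open>
  The circle through \<open>x\<close>, \<open>p\<close> and \<open>y\<close> has its centre at least as far from the chord as the circles of
  radius \<open>r\<close>, on the side opposite to \<open>p\<close>.
\<close>

lemma spindle_point_on_flatter_short_arc:
  assumes xy: "0 < dist x y" and d: "dist x y < 2 * r"
    and p: "p \<in> spindle r x y" and off: "across x y p \<noteq> 0"
  obtains R where "r \<le> R" "dist x y < 2 * R" "p \<in> \<Union> (short_arcs R x y)"
proof -
  define a where "a = along x y p"
  define b where "b = across x y p"
  define D where "D = dist x y / 2"
  define h where "h = centre_height r x y"
  have b: "0 < b" using off by (simp add: b_def across_def)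
  have D: "0 < D" using xy by (simp add: D_def)
  have hr: "h\<^sup>2 + D\<^sup>2 = r\<^sup>2" and h: "0 < h"
    using centre_height_sq[OF xy d] centre_height_pos[OF xy d] by (simp_all add: h_def D_def)
  have "a\<^sup>2 + (b + h)\<^sup>2 \<le> r\<^sup>2"
    using p mem_spindle_iff[OF xy d] by (simp add: a_def b_def h_def)
  then have le: "h * (2 * b) \<le> D\<^sup>2 - a\<^sup>2 - b\<^sup>2" using hr by (simp add: power2_sum algebra_simps)
  \<comment> \<open>The height of the centre of the circle through \<open>x\<close>, \<open>p\<close> and \<open>y\<close>, below the chord.\<close>
  define h' where "h' = (D\<^sup>2 - a\<^sup>2 - b\<^sup>2) / (2 * b)"
  define R where "R = sqrt (h'\<^sup>2 + D\<^sup>2)"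
  have "h \<le> h'" using le b by (simp add: h'_def pos_le_divide_eq)
  then have "h\<^sup>2 \<le> h'\<^sup>2" using h by (intro power_mono) auto
  then have "r\<^sup>2 \<le> h'\<^sup>2 + D\<^sup>2" using hr by linarith
  then have rR: "r \<le> R" unfolding R_def by (rule real_le_rsqrt)
  then have dR: "dist x y < 2 * R" using d by linarith
  have R2: "R\<^sup>2 = h'\<^sup>2 + D\<^sup>2" by (simp add: R_def)
  then have hR: "centre_height R x y = h'"
    using \<open>h \<le> h'\<close> h by (simp add: centre_height_def D_def)
  have "2 * b * h' = D\<^sup>2 - a\<^sup>2 - b\<^sup>2" using b by (simp add: h'_def)
  then have "a\<^sup>2 + (b + h')\<^sup>2 = R\<^sup>2" using R2 by (simp add: power2_sum)
  then have "p \<in> frontier (spindle R x y)"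
    using mem_frontier_spindle_iff[OF xy dR] by (simp add: a_def b_def hR)
  then show ?thesis using that[OF rR dR] Union_short_arcs[OF xy dR] by simp
qed

section \<open>Length, containment and homotopy\<close>

text \<open>
  The arcs have unit speed, so the length is the norm of the derivative of the rescaled arc, and the
  length is \<open>1\<close>-Lipschitz for the \<open>C\<^sup>1\<close> distance.
\<close>

lemma continuous_map_length: "continuous_map (arc_space \<kappa> x y) euclideanreal fst"
  unfolding arc_space_def Metric_space.continuous_map_from_metric[OF Metric_space_constrained_arcs]
proof (intro conjI ballI allI impI)
  fix a U assume a: "a \<in> constrained_arcs \<kappa> x y" and U: "openin euclidean U \<and> fst a \<in> U"
  then obtain \<epsilon> where \<epsilon>: "0 < \<epsilon>" "ball (fst a) \<epsilon> \<subseteq> U"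
    using open_contains_ball by (metis open_openin)
  have "dist (fst a) (fst b) \<le> C1_dist a b" if b: "b \<in> constrained_arcs \<kappa> x y" for b
  proof -
    obtain s \<beta> t \<gamma> where ab: "a = (s, \<beta>)" "b = (t, \<gamma>)" by (cases a, cases b)
    have C: "C1_curve s \<beta>" "C1_curve t \<gamma>" "norm (velocity s \<beta> 0) = 1" "norm (velocity t \<gamma> 0) = 1"
      using a b by (auto simp: ab constrained_arcs_def constrained_arc_def C1_curve_def)
    have pos: "0 < s" "0 < t" using C by (auto simp: C1_curve_def)
    have c: "continuous_on {0..1} (\<lambda>u. rescale a u - rescale b u)"
      "continuous_on {0..1} (\<lambda>u. rescale_deriv a u - rescale_deriv b u)"
      using C by (auto intro!: continuous_on_diff continuous_on_rescale simp: ab)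
    have "dist s t = \<bar>norm (rescale_deriv a 0) - norm (rescale_deriv b 0)\<bar>"
      using rescale_deriv_eq[OF C(1), of 0] rescale_deriv_eq[OF C(2), of 0] C(3,4) pos
      by (simp add: ab dist_real_def)
    also have "\<dots> \<le> norm (rescale_deriv a 0 - rescale_deriv b 0)" by (rule norm_triangle_ineq3)
    also have "\<dots> \<le> (SUP u\<in>{0..1}. norm (rescale_deriv a u - rescale_deriv b u))"
      using sup_norm_facts(2)[OF c(2), of 0] by simp
    also have "\<dots> \<le> C1_dist a b"
      using sup_norm_facts(3)[OF c(1)] C by (simp add: C1_dist_def ab)
    finally show ?thesis by (simp add: ab)
  qed
  then show "\<exists>r>0. \<forall>b. b \<in> constrained_arcs \<kappa> x y \<and> C1_dist a b < r \<longrightarrow> fst b \<in> U"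
    using \<epsilon> by (intro exI[of _ \<epsilon>]) force
qed auto

lemma constrained_homotopic_sym:
  "constrained_homotopic \<kappa> x y a b \<Longrightarrow> constrained_homotopic \<kappa> x y b a"
  by (simp add: constrained_homotopic_eq path_component_of_sym)

lemma constrained_homotopic_trans:
  "constrained_homotopic \<kappa> x y a b \<Longrightarrow> constrained_homotopic \<kappa> x y b c \<Longrightarrow>
   constrained_homotopic \<kappa> x y a c"
  unfolding constrained_homotopic_eq by (rule path_component_of_trans)

lemma length_neq_half_circumference:
  assumes "0 < \<kappa>" and "dist x y < 2 / \<kappa>" and "(s, \<gamma>) \<in> constrained_arcs \<kappa> x y"
  shows "s \<noteq> pi / \<kappa>"
proof
  assume s: "s = pi / \<kappa>"
  have arc: "constrained_arc \<kappa> s \<gamma>" "\<gamma> 0 = x" "\<gamma> s = y"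
    using assms(3) by (auto simp: constrained_arcs_def)
  interpret unit_speed_curve \<kappa> s \<gamma> "velocity s \<gamma>"
    using constrained_arc_imp_unit_speed[OF assms(1) arc(1)] .
  have "2 / \<kappa> \<le> norm (y - x)"
    using long_curve_has_distant_points arc s by simp
  then show False using assms(2) by (simp add: dist_norm norm_minus_commute)
qed

text \<open>
  By the intermediate value theorem a homotopy from a shorter to a longer arc passes through an
  arc of length \<open>\<pi> / \<kappa>\<close>.
\<close>

lemma homotopic_length_less:
  assumes \<kappa>: "0 < \<kappa>" and d: "dist x y < 2 / \<kappa>"
    and hom: "constrained_homotopic \<kappa> x y a b" and less: "fst a < pi / \<kappa>"
  shows "fst b < pi / \<kappa>"
proof (rule ccontr)
  assume "\<not> fst b < pi / \<kappa>"
  then have ge: "pi / \<kappa> \<le> fst b" by simp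
  obtain H where H: "pathin (arc_space \<kappa> x y) H" "H 0 = a" "H 1 = b"
    using hom by (auto simp: constrained_homotopic_def)
  have "pathin euclideanreal (fst \<circ> H)"
    using H(1) continuous_map_length by (rule pathin_compose)
  then have "continuous_on {0..1} (fst \<circ> H)" by (simp add: pathin_def)
  then obtain p where p: "0 \<le> p" "p \<le> 1" "(fst \<circ> H) p = pi / \<kappa>"
    using IVT'[of "fst \<circ> H" 0 "pi / \<kappa>" 1] less ge H by auto
  have "H p \<in> topspace (arc_space \<kappa> x y)"
    using H(1) p by (auto simp: pathin_def continuous_map_def)
  then have "(pi / \<kappa>, snd (H p)) \<in> constrained_arcs \<kappa> x y"
    using p(3) by (metis comp_apply prod.collapse topspace_arc_space)
  then show False using length_neq_half_circumference[OF \<kappa> d] by blast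
qed

text \<open>
  A long arc has two points farther apart than the diameter of the spindle. A short arc cannot leave
  any of the balls whose intersection is the spindle, because its endpoints are in all of them.
\<close>

lemma arc_in_spindle_iff:
  assumes \<kappa>: "0 < \<kappa>" and d: "dist x y < 2 / \<kappa>" and arc: "(s, \<gamma>) \<in> constrained_arcs \<kappa> x y"
  shows "\<gamma> ` {0..s} \<subseteq> spindle (1 / \<kappa>) x y \<longleftrightarrow> s < pi / \<kappa>"
proof -
  have ca: "constrained_arc \<kappa> s \<gamma>" and ends: "\<gamma> 0 = x" "\<gamma> s = y"
    using arc by (auto simp: constrained_arcs_def)
  interpret unit_speed_curve \<kappa> s \<gamma> "velocity s \<gamma>"
    using constrained_arc_imp_unit_speed[OF \<kappa> ca] .
  have xy: "0 < dist x y" using ca ends by (auto simp: constrained_arc_def)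
  have d': "dist x y < 2 * (1 / \<kappa>)" using d by simp
  show ?thesis
  proof
    assume sub: "\<gamma> ` {0..s} \<subseteq> spindle (1 / \<kappa>) x y"
    show "s < pi / \<kappa>"
    proof (rule ccontr)
      assume "\<not> s < pi / \<kappa>"
      then have ge: "pi / \<kappa> \<le> s" by simp
      have "0 \<le> pi / \<kappa>" using \<kappa> by simp
      then have mem: "0 \<in> {0..s}" "pi / \<kappa> \<in> {0..s}" using ge by auto
      have "\<gamma> ` {0..s} \<subseteq> cball (midpoint x y) (dist x y / 2)"
        using sub spindle_subset_cball[OF xy d'] by blast
      then have "dist (midpoint x y) (\<gamma> 0) \<le> dist x y / 2"
        "dist (midpoint x y) (\<gamma> (pi / \<kappa>)) \<le> dist x y / 2"
        using mem by (metis image_subset_iff mem_cball)+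
      then have "dist (\<gamma> (pi / \<kappa>)) (\<gamma> 0) \<le> dist x y"
        using dist_triangle3[of "\<gamma> (pi / \<kappa>)" "\<gamma> 0" "midpoint x y"] by linarith
      moreover have "2 / \<kappa> \<le> dist (\<gamma> (pi / \<kappa>)) (\<gamma> 0)"
        using long_curve_has_distant_points[OF ge] by (simp add: dist_norm)
      ultimately show False using d by linarith
    qed
  next
    assume short: "s < pi / \<kappa>"
    show "\<gamma> ` {0..s} \<subseteq> spindle (1 / \<kappa>) x y"
    proof (rule image_subsetI)
      fix t assume t: "t \<in> {0..s}"
      show "\<gamma> t \<in> spindle (1 / \<kappa>) x y"
        unfolding spindle_def
      proof (rule INT_I)
        fix c assume "c \<in> {c. dist c x = 1 / \<kappa> \<and> dist c y = 1 / \<kappa>}"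
        then have "dist c (\<gamma> 0) \<le> 1 / \<kappa>" "dist c (\<gamma> s) \<le> 1 / \<kappa>" using ends by auto
        from short_curve_in_ball[OF short this t] show "\<gamma> t \<in> cball c (1 / \<kappa>)" by simp
      qed
    qed
  qed
qed

section \<open>Straightening short arcs\<close>

lemma segment_constrained_arc:
  assumes "0 < \<kappa>" "x \<noteq> y"
  shows "constrained_arc \<kappa> (dist x y) (\<lambda>t\<in>{0..dist x y}. x + t *\<^sub>R chord_axis x y)"
    and "\<And>t. t \<in> {0..dist x y} \<Longrightarrow>
      velocity (dist x y) (\<lambda>t\<in>{0..dist x y}. x + t *\<^sub>R chord_axis x y) t = chord_axis x y"
proof -
  have 1: "((\<lambda>t. x + t *\<^sub>R chord_axis x y) has_vector_derivative chord_axis x y) (at t within S)" for t S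
    by (auto intro!: derivative_eq_intros)
  have 2: "inj_on (\<lambda>t. x + t *\<^sub>R chord_axis x y) {0..dist x y}"
    using norm_axis[OF assms(2)] by (auto intro!: inj_onI)
  show "constrained_arc \<kappa> (dist x y) (\<lambda>t\<in>{0..dist x y}. x + t *\<^sub>R chord_axis x y)"
    and "\<And>t. t \<in> {0..dist x y} \<Longrightarrow>
      velocity (dist x y) (\<lambda>t\<in>{0..dist x y}. x + t *\<^sub>R chord_axis x y) t = chord_axis x y"
    using assms 2 norm_axis[OF assms(2)] 1
    by (auto intro!: constrained_arc_restrictI[of \<kappa> "dist x y" _ "\<lambda>_. chord_axis x y" "{}" "\<lambda>_. 0"])
qed

text \<open>
  All arcs start at \<open>x\<close>, so a bound on the difference of the derivatives also bounds the difference
  of the positions.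
\<close>

lemma C1_dist_le:
  assumes a: "a \<in> constrained_arcs \<kappa> x y" and b: "b \<in> constrained_arcs \<kappa> x y"
    and \<eta>: "\<And>u. u \<in> {0..1} \<Longrightarrow> norm (rescale_deriv a u - rescale_deriv b u) \<le> \<eta>"
  shows "C1_dist a b \<le> 2 * \<eta>"
proof -
  obtain s \<beta> t \<gamma> where ab: "a = (s, \<beta>)" "b = (t, \<gamma>)" by (cases a, cases b)
  have C: "C1_curve s \<beta>" "C1_curve t \<gamma>" "\<beta> 0 = x" "\<gamma> 0 = x"
    using a b by (auto simp: ab constrained_arcs_def constrained_arc_def)
  have \<eta>0: "0 \<le> \<eta>" using order_trans[OF norm_ge_zero \<eta>[of 0]] by simp
  have "norm (rescale a u - rescale b u) \<le> \<eta>" if u: "u \<in> {0..1}" for u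
  proof -
    have der: "((\<lambda>u. rescale a u - rescale b u) has_vector_derivative
        rescale_deriv a v - rescale_deriv b v) (at v within {0..u})" if v: "v \<in> {0..u}" for v
    proof -
      have v1: "v \<in> {0..1}" using u v by auto
      have "((\<lambda>u. rescale a u - rescale b u) has_vector_derivative
          rescale_deriv a v - rescale_deriv b v) (at v within {0..1})"
        using rescale_has_vector_derivative[OF C(1) v1] rescale_has_vector_derivative[OF C(2) v1]
        by (simp add: ab rescale_deriv_eq[OF C(1) v1] rescale_deriv_eq[OF C(2) v1]
            has_vector_derivative_diff)
      then show ?thesis by (rule has_vector_derivative_within_subset) (use u in auto)
    qed
    have "((\<lambda>v. rescale_deriv a v - rescale_deriv b v) has_integral
        ((rescale a u - rescale b u) - (rescale a 0 - rescale b 0))) {0..u}"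
      using u der by (intro fundamental_theorem_of_calculus) auto
    from has_integral_bound_real[OF \<eta>0 finite.emptyI this]
    have "norm (rescale a u - rescale b u) \<le> \<eta> * u"
      using u \<eta> C by (simp add: ab rescale_def)
    also have "\<dots> \<le> \<eta>" using u \<eta>0 by (simp add: mult_left_le)
    finally show ?thesis .
  qed
  then have "(SUP u\<in>{0..1}. norm (rescale a u - rescale b u)) \<le> \<eta>"
    by (intro cSUP_least) auto
  moreover have "(SUP u\<in>{0..1}. norm (rescale_deriv a u - rescale_deriv b u)) \<le> \<eta>"
    using \<eta> by (intro cSUP_least) auto
  ultimately show ?thesis using C by (simp add: C1_dist_def ab)
qed

text \<open>
  A jointly continuous derivative is uniformly continuous on the unit square, so it varies uniformly
  with the parameter of the path.
\<close>

lemma pathin_arc_spaceI: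
  assumes H: "\<And>p. p \<in> {0..1} \<Longrightarrow> H p \<in> constrained_arcs \<kappa> x y"
    and G: "continuous_on ({0..1} \<times> {0..1}) (\<lambda>z. G (fst z) (snd z))"
    and eq: "\<And>p u. p \<in> {0..1} \<Longrightarrow> u \<in> {0..1} \<Longrightarrow> rescale_deriv (H p) u = G p u"
  shows "pathin (arc_space \<kappa> x y) H"
  unfolding pathin_def arc_space_def Metric_space.continuous_map_to_metric[OF Metric_space_constrained_arcs]
proof (intro ballI allI impI)
  fix p and \<epsilon> :: real assume "p \<in> topspace (subtopology euclideanreal {0..1})" and \<epsilon>: "0 < \<epsilon>"
  then have p: "p \<in> {0..1}" by simp
  have "uniformly_continuous_on ({0..1} \<times> {0..1}) (\<lambda>z. G (fst z) (snd z))"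
    using G by (intro compact_uniformly_continuous compact_Times) auto
  then obtain \<delta> where \<delta>: "0 < \<delta>" and unif: "\<And>z z'. z \<in> {0..1} \<times> {0..1} \<Longrightarrow> z' \<in> {0..1} \<times> {0..1} \<Longrightarrow>
      dist z' z < \<delta> \<Longrightarrow> dist (G (fst z') (snd z')) (G (fst z) (snd z)) < \<epsilon> / 3"
    using \<epsilon> unfolding uniformly_continuous_on_def by (metis divide_pos_pos zero_less_numeral)
  have "H p' \<in> Metric_space.mball (constrained_arcs \<kappa> x y) C1_dist (H p) \<epsilon>"
    if p': "p' \<in> {0..1}" "dist p p' < \<delta>" for p'
  proof -
    have "C1_dist (H p) (H p') \<le> 2 * (\<epsilon> / 3)"
    proof (rule C1_dist_le[OF H[OF p] H[OF p'(1)]])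
      fix u :: real assume u: "u \<in> {0..1}"
      have "dist (p, u) (p', u) < \<delta>" using p' by (simp add: dist_Pair_Pair)
      then have "dist (G p u) (G p' u) < \<epsilon> / 3"
        using unif[of "(p', u)" "(p, u)"] p p' u by simp
      then show "norm (rescale_deriv (H p) u - rescale_deriv (H p') u) \<le> \<epsilon> / 3"
        using eq[OF p u] eq[OF p'(1) u] by (simp add: dist_norm)
    qed
    then have "C1_dist (H p) (H p') < \<epsilon>" using \<epsilon> by simp
    then show ?thesis
      using H[OF p] H[OF p'(1)]
      by (simp add: Metric_space.in_mball[OF Metric_space_constrained_arcs])
  qed
  then show "\<exists>U. openin (subtopology euclideanreal {0..1}) U \<and> p \<in> U \<and>
      (\<forall>p'\<in>U. H p' \<in> Metric_space.mball (constrained_arcs \<kappa> x y) C1_dist (H p) \<epsilon>)"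
    using p \<delta> by (intro exI[of _ "{0..1} \<inter> ball p \<delta>"]) (auto simp: openin_open_Int)
qed

text \<open>
  The rotation by \<open>\<pi>\<close> about the line through \<open>w\<close> (in any dimension: \<open>w\<close> is fixed and its orthogonal
  complement is reversed).
\<close>

definition half_turn :: "'a::real_inner \<Rightarrow> 'a \<Rightarrow> 'a" where
  "half_turn w v = (2 * (w \<bullet> v) / (w \<bullet> w)) *\<^sub>R w - v"

lemma linear_half_turn: "linear (half_turn w)"
  unfolding half_turn_def
  by (intro linearI) (simp_all add: inner_add_right algebra_simps add_divide_distrib)

lemma norm_half_turn: "norm (half_turn w v) = norm v"
proof (cases "w = 0")
  case False
  define k where "k = (w \<bullet> v) / (w \<bullet> w)"
  have k: "w \<bullet> v = k * (w \<bullet> w)" using False by (simp add: k_def)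
  have eq: "half_turn w v = (2 * k) *\<^sub>R w - v" by (simp add: half_turn_def k_def)
  have "half_turn w v \<bullet> half_turn w v = v \<bullet> v"
    unfolding eq inner_diff_left inner_diff_right inner_scaleR_left inner_scaleR_right
      inner_commute[of v w] k by (simp add: algebra_simps)
  then show ?thesis by (simp add: norm_eq_sqrt_inner)
qed (simp add: half_turn_def)

lemma half_turn_self: "half_turn w w = w"
  by (cases "w = 0") (simp_all add: half_turn_def scaleR_2)

lemma half_turn_scaleR: "c \<noteq> 0 \<Longrightarrow> half_turn (c *\<^sub>R w) = half_turn w"
  by (rule ext) (simp add: half_turn_def)

lemma half_turn_involution: "half_turn w (half_turn w v) = v"
proof (cases "w = 0")
  case False
  have "w \<bullet> half_turn w v = w \<bullet> v"
    using False by (simp add: half_turn_def inner_diff_right)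
  then show ?thesis by (simp add: half_turn_def[of w "half_turn w v"]) (simp add: half_turn_def)
qed (simp add: half_turn_def)

text \<open>
  An isometry which takes the direction of \<open>w\<close> to the direction \<open>e\<close>. The half turn about the bisector
  of the two directions would do this as well, but it is not the identity when \<open>w\<close> points
  along \<open>e\<close>; the preceding half turn about \<open>w\<close> corrects this. For a unit vector \<open>e\<close> all this holds, and
  depends continuously on \<open>w\<close>, as long as \<open>w\<close> is nonzero and not opposite to \<open>e\<close>.
\<close>

definition align :: "'a::real_inner \<Rightarrow> 'a \<Rightarrow> 'a \<Rightarrow> 'a" where
  "align e w v = half_turn (w + norm w *\<^sub>R e) (half_turn w v)"

lemma linear_align: "linear (align e w)"
  unfolding align_def
  using linear_compose[OF linear_half_turn linear_half_turn] by (simp add: o_def)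

lemma norm_align: "norm (align e w v) = norm v"
  by (simp add: align_def norm_half_turn)

lemma align_direction:
  assumes "norm e = 1" "w + norm w *\<^sub>R e \<noteq> 0"
  shows "align e w w = norm w *\<^sub>R e"
proof -
  let ?m = "w + norm w *\<^sub>R e"
  have "e \<bullet> e = 1" "w \<bullet> w = norm w * norm w"
    using assms(1) by (simp_all add: norm_eq_1 dot_square_norm power2_eq_square)
  then have "?m \<bullet> ?m = 2 * (?m \<bullet> w)"
    unfolding inner_add_left inner_add_right inner_scaleR_left inner_scaleR_right
      inner_commute[of w e] by (simp add: algebra_simps)
  moreover have "?m \<bullet> ?m \<noteq> 0" using assms(2) by simp
  ultimately have *: "2 * (?m \<bullet> w) / (?m \<bullet> ?m) = 1" by simp
  show ?thesis unfolding align_def half_turn_self unfolding half_turn_def * by simp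
qed

lemma align_parallel:
  assumes "norm e = 1" "0 < c"
  shows "align e (c *\<^sub>R e) v = v"
proof -
  have "c *\<^sub>R e + norm (c *\<^sub>R e) *\<^sub>R e = (2 * c) *\<^sub>R e" using assms by (simp flip: scaleR_add_left)
  then show ?thesis
    using assms by (simp add: align_def half_turn_scaleR half_turn_involution)
qed

definition segment_arc :: "real^3 \<Rightarrow> real^3 \<Rightarrow> curve" where
  "segment_arc x y = (dist x y, \<lambda>t\<in>{0..dist x y}. x + t *\<^sub>R chord_axis x y)"

lemma segment_arc_in_constrained_arcs:
  assumes "0 < \<kappa>" "x \<noteq> y"
  shows "segment_arc x y \<in> constrained_arcs \<kappa> x y"
  using segment_constrained_arc(1)[OF assms] assms(2)
  by (auto simp: segment_arc_def constrained_arcs_def chord_axis_def)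

text \<open>
  At time \<open>p\<close> the homotopy shows the initial piece of length \<open>p s\<close>, turned and enlarged so that it runs
  from \<open>x\<close> to \<open>y\<close>. The chords of the initial pieces increase with \<open>p\<close> since the arc is short, so the factor
  of enlargement is at least \<open>1\<close> and the curvature bound is kept. As \<open>p\<close> tends to \<open>0\<close> the
  piece is nearly straight and the limit is the segment. All chords make an acute angle with the
  initial tangent, so no chord is opposite to \<open>y - x\<close> and the turning is continuous.
\<close>

lemma short_arc_homotopic_to_segment:
  assumes \<kappa>: "0 < \<kappa>" and arc: "(s, \<gamma>) \<in> constrained_arcs \<kappa> x y" and short: "s < pi / \<kappa>"
  shows "constrained_homotopic \<kappa> x y (segment_arc x y) (s, \<gamma>)"
proof -
  have ca: "constrained_arc \<kappa> s \<gamma>" and ends: "\<gamma> 0 = x" "\<gamma> s = y"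
    using arc by (auto simp: constrained_arcs_def)
  have xy: "x \<noteq> y" using ca ends by (auto simp: constrained_arc_def)
  define T where "T = velocity s \<gamma>"
  interpret unit_speed_curve \<kappa> s \<gamma> T
    unfolding T_def using constrained_arc_imp_unit_speed[OF \<kappa> ca] .
  define d where "d = dist x y"
  define e where "e = chord_axis x y"
  have d: "0 < d" using xy by (simp add: d_def)
  have e1: "norm e = 1" using norm_axis[OF xy] by (simp add: e_def)
  have de: "y - x = d *\<^sub>R e" using xy by (simp add: d_def e_def chord_axis_def)
  \<comment> \<open>The chord slope \<open>q\<close>, extended continuously to the starting point by the tangent.\<close>
  define q where "q b = (if b = 0 then T 0 else (\<gamma> b - x) /\<^sub>R b)" for b
  have chord: "\<gamma> b - x = b *\<^sub>R q b" if "b \<noteq> 0" for b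
    using that by (simp add: q_def)
  have q_cont: "continuous_on {0..s} q"
    unfolding continuous_on_eq_continuous_within
  proof
    fix b assume b: "b \<in> {0..s}"
    show "continuous (at b within {0..s}) q"
    proof (cases "b = 0")
      case True
      have "((\<lambda>t. (1 / norm (t - 0)) *\<^sub>R (\<gamma> t - (\<gamma> 0 + (t - 0) *\<^sub>R T 0))) \<longlongrightarrow> 0) (at 0 within {0..s})"
        using has_tangent[of 0] length_pos
        unfolding has_vector_derivative_def has_derivative_within by simp
      then have "((\<lambda>t. (1 / norm (t - 0)) *\<^sub>R (\<gamma> t - (\<gamma> 0 + (t - 0) *\<^sub>R T 0)) + T 0) \<longlongrightarrow> 0 + T 0)
          (at 0 within {0..s})" by (intro tendsto_intros)
      moreover have "\<forall>\<^sub>F t in at 0 within {0..s}.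
          (1 / norm (t - 0)) *\<^sub>R (\<gamma> t - (\<gamma> 0 + (t - 0) *\<^sub>R T 0)) + T 0 = q t"
        unfolding eventually_at_filter
        by (rule always_eventually) (auto simp: q_def ends inverse_eq_divide scaleR_diff_right
            scaleR_add_right)
      ultimately have "(q \<longlongrightarrow> 0 + T 0) (at 0 within {0..s})"
        by (rule Lim_transform_eventually)
      then show ?thesis by (simp add: continuous_within True q_def)
    next
      case False
      have "continuous (at b within {0..s}) (\<lambda>t. (\<gamma> t - x) /\<^sub>R t)"
        using False b continuous_curve by (intro continuous_intros)
          (auto simp: continuous_on_eq_continuous_within)
      moreover have "\<forall>\<^sub>F t in at b within {0..s}. (\<gamma> t - x) /\<^sub>R t = q t"
        using eventually_neq_at_within[of 0 b "{0..s}"] by eventually_elim (simp add: q_def)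
      ultimately show ?thesis
        unfolding continuous_within using False
        by (auto simp: q_def elim: Lim_transform_eventually)
    qed
  qed
  have q_T0: "0 < q b \<bullet> T 0" if "b \<in> {0..s}" for b
  proof (cases "b = 0")
    case True
    then show ?thesis using unit_tangent[of 0] length_pos by (simp add: q_def norm_eq_1)
  next
    case False
    then have "0 < (\<gamma> b - \<gamma> 0) \<bullet> T 0"
      using that short by (intro displacement_inner_initial_tangent) auto
    then show ?thesis using False that by (simp add: q_def ends)
  qed
  have e_T0: "0 < e \<bullet> T 0"
  proof -
    have "0 < (y - x) \<bullet> T 0"
      using displacement_inner_initial_tangent[of s] length_pos short ends by simp
    then show ?thesis using d by (simp add: de zero_less_mult_iff)
  qed
  have q_nz: "q b \<noteq> 0" "q b + norm (q b) *\<^sub>R e \<noteq> 0" if "b \<in> {0..s}" for b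
  proof -
    show "q b \<noteq> 0" using q_T0[OF that] by auto
    have "0 < q b \<bullet> T 0 + norm (q b) * (e \<bullet> T 0)"
      using q_T0[OF that] e_T0 by (intro add_pos_nonneg) auto
    then have "0 < (q b + norm (q b) *\<^sub>R e) \<bullet> T 0" by (simp add: inner_add_left)
    then show "q b + norm (q b) *\<^sub>R e \<noteq> 0" by auto
  qed
  \<comment> \<open>\<open>\<mu> b\<close> is the factor by which the chord of the initial piece of length \<open>b\<close> is enlarged.\<close>
  define \<mu> where "\<mu> b = d / (b * norm (q b))" for b
  define H where "H p = (if p = 0 then segment_arc x y else
      (\<mu> (p * s) * (p * s),
       \<lambda>t\<in>{0..\<mu> (p * s) * (p * s)}.
         x + \<mu> (p * s) *\<^sub>R align e (q (p * s)) (\<gamma> (t / \<mu> (p * s)) - \<gamma> 0)))" for p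
  define G where "G p u = (d / norm (q (p * s))) *\<^sub>R align e (q (p * s)) (T (p * s * u))" for p u
  have ps: "p * s \<in> {0..s}" if "p \<in> {0..1}" for p
    using that length_pos by (simp add: mult_le_cancel_right2)
  have \<mu>1: "1 \<le> \<mu> b" and \<mu>b: "\<mu> b * b = d / norm (q b)" if "0 < b" "b \<le> s" for b
  proof -
    have b: "b \<in> {0..s}" using that by simp
    have "norm (\<gamma> b - \<gamma> 0) \<le> norm (\<gamma> s - \<gamma> 0)"
      using that short by (intro chord_increasing) auto
    then have "b * norm (q b) \<le> d"
      using that chord[of b] d e1 by (simp add: ends de)
    then show "1 \<le> \<mu> b" using that q_nz(1)[OF b] by (simp add: \<mu>_def)
    show "\<mu> b * b = d / norm (q b)" using that by (simp add: \<mu>_def)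
  qed
  have piece: "H p \<in> constrained_arcs \<kappa> x y \<and> (\<forall>u\<in>{0..1}. rescale_deriv (H p) u = G p u)"
    if p: "p \<in> {0..1}" for p
  proof (cases "p = 0")
    case True
    have T0: "norm (T 0) = 1" using unit_tangent[of 0] length_pos by simp
    have q0: "q 0 = T 0" by (simp add: q_def)
    have "align e (T 0) (T 0) = e"
      using align_direction[OF e1, of "T 0"] q_nz(2)[of 0] length_pos by (simp add: q0 T0)
    then have G0: "G 0 u = d *\<^sub>R e" for u by (simp add: G_def q0 T0)
    have "rescale_deriv (segment_arc x y) u = d *\<^sub>R e" if u: "u \<in> {0..1}" for u
    proof -
      have "C1_curve (dist x y) (\<lambda>t\<in>{0..dist x y}. x + t *\<^sub>R chord_axis x y)"
        using segment_constrained_arc(1)[OF \<kappa> xy] by (simp add: constrained_arc_def)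
      from rescale_deriv_eq[OF this u] show ?thesis
        using segment_constrained_arc(2)[OF \<kappa> xy, of "dist x y * u"] u
        by (simp add: segment_arc_def d_def e_def mult_left_le)
    qed
    then show ?thesis
      using segment_arc_in_constrained_arcs[OF \<kappa> xy] by (simp add: H_def True G0)
  next
    case False
    define b where "b = p * s"
    have b: "0 < b" "b \<le> s" "b \<in> {0..s}"
      using False p ps[OF p] length_pos by (auto simp: b_def)
    define g where "g = (\<lambda>t\<in>{0..\<mu> b * b}. x + \<mu> b *\<^sub>R align e (q b) (\<gamma> (t / \<mu> b) - \<gamma> 0))"
    have Hp: "H p = (\<mu> b * b, g)" using False by (simp add: H_def b_def g_def)
    have \<mu>0: "0 < \<mu> b" using \<mu>1[OF b(1,2)] by simp
    have cg: "constrained_arc \<kappa> (\<mu> b * b) g"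
      and vg: "\<And>t. t \<in> {0..\<mu> b * b} \<Longrightarrow> velocity (\<mu> b * b) g t = align e (q b) (T (t / \<mu> b))"
      unfolding g_def T_def
      using similar_subarc[OF \<kappa> ca b(1,2) \<mu>1[OF b(1,2)] linear_align norm_align] by blast+
    have len: "0 < \<mu> b * b" using \<mu>0 b by simp
    have "g 0 = x" using len by (simp add: g_def linear_0[OF linear_align])
    moreover have "g (\<mu> b * b) = y"
    proof -
      have "g (\<mu> b * b) = x + \<mu> b *\<^sub>R align e (q b) (b *\<^sub>R q b)"
        using len \<mu>0 b chord[of b] by (simp add: g_def ends)
      also have "\<dots> = x + (\<mu> b * b * norm (q b)) *\<^sub>R e"
        using align_direction[OF e1 q_nz(2)[OF b(3)]] by (simp add: linear_scale[OF linear_align] mult.assoc)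
      also have "\<dots> = x + d *\<^sub>R e" using \<mu>b[OF b(1,2)] q_nz(1)[OF b(3)] by simp
      finally show ?thesis using de by (simp add: algebra_simps)
    qed
    ultimately have "H p \<in> constrained_arcs \<kappa> x y" using cg by (simp add: Hp constrained_arcs_def)
    moreover have "rescale_deriv (H p) u = G p u" if u: "u \<in> {0..1}" for u
    proof -
      have "C1_curve (\<mu> b * b) g" using cg by (simp add: constrained_arc_def)
      from rescale_deriv_eq[OF this u]
      have "rescale_deriv (H p) u = (\<mu> b * b) *\<^sub>R align e (q b) (T (\<mu> b * b * u / \<mu> b))"
        using vg[of "\<mu> b * b * u"] u len by (simp add: Hp mult_left_le)
      also have "\<mu> b * b * u / \<mu> b = b * u" using \<mu>0 by simp
      finally show ?thesis unfolding \<mu>b[OF b(1,2)] by (simp add: G_def b_def)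
    qed
    ultimately show ?thesis by blast
  qed
  have G_cont: "continuous_on ({0..1} \<times> {0..1}) (\<lambda>z. G (fst z) (snd z))"
  proof -
    have 1: "continuous_on ({0..1} \<times> {0..1}) (\<lambda>z. q (fst z * s))"
      by (rule continuous_on_compose2[OF q_cont]) (auto intro!: continuous_intros dest: ps)
    have "fst z * s * snd z \<in> {0..s}" if "z \<in> {0..1} \<times> {0..1}" for z :: "real \<times> real"
    proof -
      have "fst z * s \<in> {0..s}" "snd z \<in> {0..1}" using that ps by auto
      then show ?thesis by (auto intro: order_trans[OF mult_left_le])
    qed
    then have 2: "continuous_on ({0..1} \<times> {0..1}) (\<lambda>z. T (fst z * s * snd z))"
      by (intro continuous_on_compose2[OF continuous_tangent] continuous_intros) auto
    have nz: "q (fst z * s) \<noteq> 0" "q (fst z * s) + norm (q (fst z * s)) *\<^sub>R e \<noteq> 0"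
      if "z \<in> {0..1} \<times> {0..1}" for z :: "real \<times> real"
      using that q_nz ps by auto
    show ?thesis
      unfolding G_def align_def half_turn_def
      by (intro continuous_intros 1 2) (use nz in auto)
  qed
  have "pathin (arc_space \<kappa> x y) H"
    using piece G_cont by (intro pathin_arc_spaceI) auto
  moreover have "H 0 = segment_arc x y" by (simp add: H_def)
  moreover have "H 1 = (s, \<gamma>)"
  proof -
    have s: "0 < s" "s \<in> {0..s}" using length_pos by auto
    have "s *\<^sub>R q s = d *\<^sub>R e" using chord[of s] s by (simp add: ends de)
    then have "q s = (d / s) *\<^sub>R e" using s
      by (metis divide_inverse_commute less_irrefl scaleR_scaleR left_inverse scaleR_one)
    then have "align e (q s) v = v" and nq: "norm (q s) = d / s" for v
      using align_parallel[OF e1, of "d / s"] e1 d s by simp_all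
    moreover have "\<mu> s = 1" using d s by (simp add: \<mu>_def nq)
    moreover have "\<gamma> \<in> extensional {0..s}" using ca by (simp add: constrained_arc_def C1_curve_def)
    ultimately show ?thesis
      by (auto simp: H_def ends extensional_restrict fun_eq_iff restrict_def extensional_def)
  qed
  ultimately show ?thesis unfolding constrained_homotopic_def by blast
qed

section \<open>Covering the spindle by short arcs\<close>

text \<open>
  The length is estimated through the position: the circular arc is in the spindle of radius \<open>R\<close>,
  hence in the one of radius \<open>1 / \<kappa>\<close>, and such arcs are short.
\<close>

lemma short_arc_constrained:
  assumes \<kappa>: "0 < \<kappa>" and xy: "0 < dist x y" and d: "dist x y < 2 / \<kappa>" and R: "1 / \<kappa> \<le> R"
    and X: "X \<in> short_arcs R x y"
  obtains s \<gamma> where "(s, \<gamma>) \<in> constrained_arcs \<kappa> x y" "s < pi / \<kappa>" "\<gamma> ` {0..s} = X"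
proof -
  have d': "dist x y < 2 * (1 / \<kappa>)" using d by simp
  have dR: "dist x y < 2 * R" using d' R by linarith
  have Rpos: "0 < R" using xy dR by linarith
  obtain c u v \<alpha> where X': "X = circular_arc c u v R \<alpha>"
    and arc: "norm u = 1" "norm v = 1" "u \<bullet> v = 0" "circle_point c u v R 0 = x"
      "circle_point c u v R \<alpha> = y" "0 < \<alpha>" "\<alpha> < 2 * pi - \<alpha>"
    using X unfolding short_arcs_def mem_Collect_eq by blast
  define \<gamma> where "\<gamma> = (\<lambda>t\<in>{0..R * \<alpha>}. circle_point c u v R (t / R))"
  have "\<alpha> < 2 * pi" using arc by linarith
  then have "constrained_arc \<kappa> (R * \<alpha>) \<gamma>"
    unfolding \<gamma>_def using circular_constrained_arc[OF \<kappa> R arc(1-3,6)] by simp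
  moreover have "\<gamma> 0 = x" "\<gamma> (R * \<alpha>) = y" using arc Rpos by (simp_all add: \<gamma>_def)
  ultimately have mem: "(R * \<alpha>, \<gamma>) \<in> constrained_arcs \<kappa> x y" by (simp add: constrained_arcs_def)
  have "(\<lambda>t. t / R) ` {0..R * \<alpha>} = {0..\<alpha>}"
    using Rpos arc(6) by (simp add: image_divide_atLeastAtMost)
  moreover have "\<gamma> ` {0..R * \<alpha>} = circle_point c u v R ` (\<lambda>t. t / R) ` {0..R * \<alpha>}"
    unfolding \<gamma>_def image_image by (rule image_restrict_eq)
  ultimately have image: "\<gamma> ` {0..R * \<alpha>} = X" by (simp add: X' circular_arc_def)
  have "X \<subseteq> frontier (spindle R x y)" using X Union_short_arcs[OF xy dR] by blast
  also have "\<dots> \<subseteq> spindle R x y"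
    by (intro frontier_subset_compact compact_spindle xy dR)
  also have "\<dots> \<subseteq> spindle (1 / \<kappa>) x y" using xy d' R by (rule spindle_antimono)
  finally have "R * \<alpha> < pi / \<kappa>"
    using arc_in_spindle_iff[OF \<kappa> d mem] image by simp
  then show ?thesis using that mem image by blast
qed

lemma spindle_covered_by_short_arcs:
  assumes \<kappa>: "0 < \<kappa>" and xy: "0 < dist x y" and d: "dist x y < 2 / \<kappa>"
    and p: "p \<in> spindle (1 / \<kappa>) x y"
  obtains s \<gamma> where "(s, \<gamma>) \<in> constrained_arcs \<kappa> x y" "s < pi / \<kappa>" "p \<in> \<gamma> ` {0..s}"
proof (cases "across x y p = 0")
  case False
  have d': "dist x y < 2 * (1 / \<kappa>)" using d by simp
  obtain R where R: "1 / \<kappa> \<le> R" "p \<in> \<Union> (short_arcs R x y)"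
    using spindle_point_on_flatter_short_arc[OF xy d' p False] by blast
  then obtain X where X: "X \<in> short_arcs R x y" "p \<in> X" by blast
  show ?thesis
    using short_arc_constrained[OF \<kappa> xy d R(1) X(1)] that X(2) by blast
next
  case True
  have d': "dist x y < 2 * (1 / \<kappa>)" using d by simp
  have neq: "x \<noteq> y" using xy by auto
  define t where "t = along x y p + dist x y / 2"
  obtain q where p': "p = midpoint x y + along x y p *\<^sub>R chord_axis x y + across x y p *\<^sub>R q"
    using cylindrical_coordinates[OF neq] by blast
  then have "p = midpoint x y + along x y p *\<^sub>R chord_axis x y" using True by simp
  moreover have "midpoint x y = x + (dist x y / 2) *\<^sub>R chord_axis x y"
    using endpoints_on_axis(1)[OF neq] by (simp add: algebra_simps)
  ultimately have "p = x + t *\<^sub>R chord_axis x y" by (simp add: t_def algebra_simps)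
  moreover have "t \<in> {0..dist x y}"
  proof -
    have "(along x y p)\<^sup>2 \<le> (dist x y / 2)\<^sup>2"
      using p mem_spindle_iff[OF xy d'] centre_height_sq[OF xy d'] True by simp
    then have "\<bar>along x y p\<bar> \<le> dist x y / 2" by (simp add: abs_le_square_iff[symmetric])
    then show ?thesis by (auto simp: t_def)
  qed
  ultimately have "p \<in> snd (segment_arc x y) ` {0..fst (segment_arc x y)}"
    by (auto simp: segment_arc_def)
  moreover have "dist x y < pi / \<kappa>"
    using d divide_right_mono[OF pi_ge_two less_imp_le[OF \<kappa>]] by linarith
  ultimately show ?thesis
    using that[of "fst (segment_arc x y)" "snd (segment_arc x y)"]
      segment_arc_in_constrained_arcs[OF \<kappa> neq] by (simp add: segment_arc_def)
qed

section \<open>Trapping\<close>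

theorem theorem3p9:
  fixes \<kappa> :: real and x y :: "real^3"
  assumes "\<kappa> > 0" and "0 < norm (x - y)" and "norm (x - y) < 2 / \<kappa>"
  shows "(\<forall>\<beta>\<in>arcs_in \<kappa> x y (closure (arc_region \<kappa> x y)).
           \<forall>\<gamma>\<in>arcs_not_in \<kappa> x y (closure (arc_region \<kappa> x y)).
             homotopy_class \<kappa> x y \<beta> \<noteq> homotopy_class \<kappa> x y \<gamma>) \<and>
         trapped_region \<kappa> x y (closure (arc_region \<kappa> x y))"
proof -
  note \<kappa> = assms(1)
  have xy: "0 < dist x y" and d: "dist x y < 2 / \<kappa>" and d': "dist x y < 2 * (1 / \<kappa>)"
    using assms(2,3) by (simp_all add: dist_norm)
  let ?S = "spindle (1 / \<kappa>) x y"
  have region: "closure (arc_region \<kappa> x y) = ?S"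
    unfolding arc_region_def by (rule closure_inside_short_arcs[OF xy d'])
  have arcs_in: "a \<in> arcs_in \<kappa> x y ?S \<longleftrightarrow> a \<in> constrained_arcs \<kappa> x y \<and> fst a < pi / \<kappa>" for a
    using arc_in_spindle_iff[OF \<kappa> d, of "fst a" "snd a"]
    by (cases a) (auto simp: arcs_in_def)
  have arcs_not_in: "a \<in> arcs_not_in \<kappa> x y ?S \<longleftrightarrow> a \<in> constrained_arcs \<kappa> x y \<and> \<not> fst a < pi / \<kappa>" for a
    using arc_in_spindle_iff[OF \<kappa> d, of "fst a" "snd a"]
    by (cases a) (auto simp: arcs_not_in_def)
  have separated: "\<not> constrained_homotopic \<kappa> x y \<beta> \<gamma>"
    if "\<beta> \<in> arcs_in \<kappa> x y ?S" "\<gamma> \<in> arcs_not_in \<kappa> x y ?S" for \<beta> \<gamma>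
    using homotopic_length_less[OF \<kappa> d] that arcs_in arcs_not_in by blast
  have trapping: "trapping_set \<kappa> x y ?S"
    unfolding trapping_set_def
  proof (intro conjI ballI)
    show "compact ?S" "connected ?S"
      using compact_spindle[OF xy d'] convex_connected[OF convex_spindle[OF xy d']] by simp_all
    have "midpoint x y \<in> ?S"
      using midpoint_in_interior_spindle[OF xy d'] interior_subset by blast
    then obtain s \<gamma> where "(s, \<gamma>) \<in> constrained_arcs \<kappa> x y" "s < pi / \<kappa>"
      using spindle_covered_by_short_arcs[OF \<kappa> xy d] by blast
    then show "arcs_in \<kappa> x y ?S \<noteq> {}" using arcs_in by auto
    show "inj_on (snd \<beta>) {0..fst \<beta>}" if "\<beta> \<in> arcs_in \<kappa> x y ?S" for \<beta>
      using that by (auto simp: arcs_in_def constrained_arcs_def constrained_arc_def)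
  qed (use separated in blast)
  have "S' = ?S" if S': "trapping_set \<kappa> x y S'" and sub: "S' \<subseteq> ?S" for S'
  proof
    obtain \<beta> where \<beta>: "\<beta> \<in> arcs_in \<kappa> x y S'" using S' by (auto simp: trapping_set_def)
    then have "\<beta> \<in> arcs_in \<kappa> x y ?S" using sub by (auto simp: arcs_in_def)
    then have "constrained_homotopic \<kappa> x y (segment_arc x y) \<beta>"
      using short_arc_homotopic_to_segment[OF \<kappa>, of "fst \<beta>" "snd \<beta>"] arcs_in by simp
    then have from_\<beta>: "constrained_homotopic \<kappa> x y \<beta> (segment_arc x y)"
      by (rule constrained_homotopic_sym)
    show "?S \<subseteq> S'"
    proof
      fix p assume "p \<in> ?S"
      then obtain s \<gamma> where arc: "(s, \<gamma>) \<in> constrained_arcs \<kappa> x y" "s < pi / \<kappa>"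
        and p: "p \<in> \<gamma> ` {0..s}"
        using spindle_covered_by_short_arcs[OF \<kappa> xy d] by blast
      have "constrained_homotopic \<kappa> x y \<beta> (s, \<gamma>)"
        using from_\<beta> short_arc_homotopic_to_segment[OF \<kappa> arc] by (rule constrained_homotopic_trans)
      then have "(s, \<gamma>) \<notin> arcs_not_in \<kappa> x y S'" using S' \<beta> by (auto simp: trapping_set_def)
      then have "\<gamma> ` {0..s} \<subseteq> S'" using arc by (auto simp: arcs_not_in_def)
      then show "p \<in> S'" using p by blast
    qed
  qed (rule sub)
  with trapping have "trapped_region \<kappa> x y ?S" by (auto simp: trapped_region_def)
  moreover have "homotopy_class \<kappa> x y \<beta> \<noteq> homotopy_class \<kappa> x y \<gamma>"
    if "\<beta> \<in> arcs_in \<kappa> x y ?S" "\<gamma> \<in> arcs_not_in \<kappa> x y ?S" for \<beta> \<gamma>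
  proof -
    have "\<gamma> \<in> homotopy_class \<kappa> x y \<gamma>"
      using that arcs_not_in
      by (auto simp: homotopy_class_def constrained_homotopic_eq path_component_of_refl)
    moreover have "\<gamma> \<notin> homotopy_class \<kappa> x y \<beta>"
      using separated[OF that] by (simp add: homotopy_class_def)
    ultimately show ?thesis by blast
  qed
  ultimately show ?thesis unfolding region by blast
qed

end
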